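(* Let $(\boldsymbol\varsigma,\boldsymbol\lambda)\in\{+,-\}^n\times\mathbb C^n$ be such that $\mathrm{Re}\,\lambda_1>\dots>\mathrm{Re}\,\lambda_{n-1}>\mathrm{Re}\,\lambda_n$. Suppose $\upsilon\in\mathscr S(\mathbb R_+)$. Then for $x>0$ $$\mathcal H_{(\boldsymbol\varsigma,\boldsymbol\lambda)}\upsilon(x)=\frac1x\int_{\mathbb R_+^n}\upsilon\Big(\frac{x_1\cdots x_n}x\Big)\Big(\prod_{l=1}^nx_l^{-\lambda_l}e^{\varsigma_lix_l}\Big)dx_n\cdots dx_1,$$ where the integral converges when performed as an iterated integral in the indicated order $dx_n\,dx_{n-1}\cdots dx_1$, starting from $dx_n$, then $dx_{n-1}$, ..., and finally $dx_1$.
   Context: Notation: $\mathbb R_+=(0,\infty)$, $e(w)=e^{2\pi iw}$. $\mathscr S(\mathbb R_+)$ is the space of smooth functions $\varphi$ on $\mathbb R_+$ with $x^{\beta}\varphi^{(\alpha)}(x)$ bounded for all $\alpha\in\mathbb N$, $\beta\in\mathbb Z$ (rapid decay of all derivatives at both $0$ and $\infty$). The Mellin transform is $\mathcal M\varphi(s)=\int_0^\infty\varphi(x)x^{s-1}dx$. Hankel transform of index $(\boldsymbol\varsigma,\boldsymbol\lambda)$: let $G(s;\boldsymbol\varsigma,\boldsymbol\lambda)=\prod_{l=1}^n\Gamma(s-\lambda_l)\,e\big(\frac{\varsigma_l(s-\lambda_l)}4\big)$. For $\upsilon\in\mathscr S(\mathbb R_+)$, $\Upsilon=\mathcal H_{(\boldsymbol\varsigma,\boldsymbol\lambda)}\upsilon$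 is the function on $\mathbb R_+$ determined by $\mathcal M\Upsilon(s)=G(s;\boldsymbol\varsigma,\boldsymbol\lambda)\,\mathcal M\upsilon(1-s)$ for $\mathrm{Re}\,s>\max_l\mathrm{Re}\,\lambda_l$; equivalently $$\Upsilon(x)=\frac1{2\pi i}\int_{\sigma-i\infty}^{\sigma+i\infty}G(s;\boldsymbol\varsigma,\boldsymbol\lambda)\,\mathcal M\upsilon(1-s)\,x^{-s}ds,\qquad\sigma>\max_l\mathrm{Re}\,\lambda_l.$$ *)

theory Defs
  imports "HOL-Analysis.Analysis"
begin

definition nth_vderiv :: "nat \<Rightarrow> (real \<Rightarrow> complex) \<Rightarrow> real \<Rightarrow> complex" where
  "nth_vderiv k f = ((\<lambda>g x. vector_derivative g (at x)) ^^ k) f"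

text \<open>Functions on the positive half-line are total functions whose values outside
  \<open>{0<..}\<close> are irrelevant. The exponent \<open>b\<close> ranges over all integers, which forces
  rapid decay at \<open>0\<close> as well as at infinity.\<close>

definition schwartz_pos :: "(real \<Rightarrow> complex) set" where
  "schwartz_pos = {f.
     (\<forall>k. \<forall>x>0. nth_vderiv k f differentiable at x) \<and>
     (\<forall>k. \<forall>b::int. bounded ((\<lambda>x. complex_of_real (x powi b) * nth_vderiv k f x) ` {0<..}))}"

definition mellin :: "(real \<Rightarrow> complex) \<Rightarrow> complex \<Rightarrow> complex" where
  "mellin f s = set_lebesgue_integral lborel {0<..} (\<lambda>x. f x * complex_of_real x powr (s - 1))"

definition ee :: "complex \<Rightarrow> complex" where
  "ee w = exp (2 * complex_of_real pi * \<i> * w)"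

text \<open>Throughout, the indices \<open>1, \<dots>, n\<close> of the mathematical text are shifted to
  \<open>0, \<dots>, n - 1\<close>, and the signs are the numbers \<open>1\<close> and \<open>-1\<close>.\<close>

definition gamma_product :: "nat \<Rightarrow> (nat \<Rightarrow> real) \<Rightarrow> (nat \<Rightarrow> complex) \<Rightarrow> complex \<Rightarrow> complex" where
  "gamma_product n sg lam s =
     (\<Prod>l<n. Gamma (s - lam l) * ee (complex_of_real (sg l) * (s - lam l) / 4))"

text \<open>The integral of \<open>g\<close> from \<open>\<sigma> - \<i>\<infinity>\<close> to \<open>\<sigma> + \<i>\<infinity>\<close>: with
  \<open>s = \<sigma> + \<i>t\<close> one has \<open>ds = \<i> dt\<close>.\<close>

definition vertical_line_integral :: "real \<Rightarrow> (complex \<Rightarrow> complex) \<Rightarrow> complex" where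
  "vertical_line_integral \<sigma> g = integral\<^sup>L lborel (\<lambda>t. g (Complex \<sigma> t) * \<i>)"

text \<open>The Hankel transform as an inverse Mellin transform along \<open>Re s = \<sigma>\<close>. The
  transform does not depend on the abscissa as long as \<open>\<sigma>\<close> exceeds the real parts
  of all \<open>lam l\<close>, \<open>l < n\<close>.\<close>

definition hankel_transform ::
  "nat \<Rightarrow> (nat \<Rightarrow> real) \<Rightarrow> (nat \<Rightarrow> complex) \<Rightarrow> real \<Rightarrow> (real \<Rightarrow> complex) \<Rightarrow> real \<Rightarrow> complex" where
  "hankel_transform n sg lam \<sigma> f x =
     1 / (2 * complex_of_real pi * \<i>) *
     vertical_line_integral \<sigma>
       (\<lambda>s. gamma_product n sg lam s * mellin f (1 - s) * complex_of_real x powr (- s))"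

text \<open>The head of the list is the outermost variable, so that \<open>iterated_integral n f\<close> is
  the integral of \<open>f [x\<^sub>1, \<dots>, x\<^sub>n]\<close> over positive \<open>x\<^sub>1, \<dots>, x\<^sub>n\<close>, performed in the
  order \<open>dx\<^sub>n\<close> (innermost), up to \<open>dx\<^sub>1\<close> (outermost).\<close>

primrec iterated_integral :: "nat \<Rightarrow> (real list \<Rightarrow> complex) \<Rightarrow> complex" where
  "iterated_integral 0 f = f []"
| "iterated_integral (Suc n) f =
     set_lebesgue_integral lborel {0<..} (\<lambda>x. iterated_integral n (\<lambda>xs. f (x # xs)))"

text \<open>Every one of the successive one-dimensional integrals converges, for all positive
  values of the variables that have not been integrated yet.\<close>

primrec iterated_integral_converges :: "nat \<Rightarrow> (real list \<Rightarrow> complex) \<Rightarrow> bool" where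
  "iterated_integral_converges 0 f \<longleftrightarrow> True"
| "iterated_integral_converges (Suc n) f \<longleftrightarrow>
     (\<forall>x>0. iterated_integral_converges n (\<lambda>xs. f (x # xs))) \<and>
     set_integrable lborel {0<..} (\<lambda>x. iterated_integral n (\<lambda>xs. f (x # xs)))"

definition hankel_integrand ::
  "nat \<Rightarrow> (nat \<Rightarrow> real) \<Rightarrow> (nat \<Rightarrow> complex) \<Rightarrow> (real \<Rightarrow> complex) \<Rightarrow> real \<Rightarrow> real list \<Rightarrow> complex" where
  "hankel_integrand n sg lam f x xs =
     f ((\<Prod>l<n. xs ! l) / x) *
     (\<Prod>l<n. complex_of_real (xs ! l) powr (- lam l) *
             exp (complex_of_real (sg l) * \<i> * complex_of_real (xs ! l)))"

end

theory Submission
  imports Defs "HOL-Probability.Sinc_Integral" "HOL-Probability.Characteristic_Functions"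
begin

text \<open>Put \<open>J\<^sub>n(y)\<close> for the iterated integral at \<open>x = 1 / y\<close>. Splitting off the outermost variable
  gives \<open>J\<^sub>n(y) = \<integral> t\<^bsup>-\<lambda>\<^esup> e\<^bsup>\<plusminus>it\<^esup> J\<^sub>n\<^sub>-\<^sub>1(yt) dt\<close> with \<open>\<lambda> = \<lambda>\<^sub>1\<close>, where \<open>J\<^sub>n\<^sub>-\<^sub>1\<close> involves
  \<open>\<lambda>\<^sub>2, \<dots>, \<lambda>\<^sub>n\<close> and \<open>J\<^sub>0 = \<upsilon>\<close>. By induction, \<open>J\<^sub>n\<close> is an absolutely convergent inverse Mellin
  integral on \<^emph>\<open>every\<close> vertical line to the right of all \<open>Re \<lambda>\<^sub>l\<close>, so no contour is ever shifted:
  the case \<open>n = 0\<close> is Mellin inversion. In the induction step, lines on either side of \<open>Re \<lambda>\<^sub>1\<close> bound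
  \<open>J\<^sub>n\<^sub>-\<^sub>1\<close> well enough at \<open>0\<close> and at infinity for absolute convergence of the \<open>t\<close>-integral. That
  integral is the limit, as \<open>\<epsilon>\<close> tends to \<open>0\<close>, of the one damped by \<open>e\<^bsup>-\<epsilon>t\<^esup>\<close>, in which Fubini and
  \<open>\<integral> t\<^bsup>w-1\<^esup> e\<^bsup>-zt\<^esup> dt = \<Gamma>(w) z\<^bsup>-w\<^esup>\<close> produce the new Gamma factor. The limit under the vertical integral
  is justified by \<open>|\<Gamma>(w)| e\<^bsup>\<pi>|Im w|/2\<^esup>\<close> being polynomially bounded on vertical lines, against the
  rapid decay of the Mellin transform of \<open>\<upsilon>\<close>.\<close>

subsection \<open>Complex Laplace transform of powers and growth of the Gamma function\<close>

lemma powr_eq_exp_ln: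
  assumes "t > 0"
  shows "complex_of_real t powr s = exp (s * of_real (ln t))"
  using assms by (simp add: powr_def Ln_of_real)

lemma set_integrable_powr_exp:
  assumes "a > -1" "r > 0"
  shows "set_integrable lborel {0<..} (\<lambda>t::real. t powr a * exp (- (r * t)))"
proof -
  have "set_integrable lebesgue {0<..} (\<lambda>t. complex_of_real t powr (of_real (a + 1) - 1) / of_real (exp (r * t)))"
    using absolutely_integrable_Gamma_integral[of "of_real (a + 1)" r] assms by simp
  from set_integrable_norm[OF this]
  have "set_integrable lebesgue {0<..} (\<lambda>t. t powr a * exp (- (r * t)))"
    by (rule set_integrable_cong[THEN iffD1, rotated -1])
       (auto simp: norm_divide norm_powr_real_powr exp_minus field_simps)
  then show ?thesis
    unfolding set_integrable_def by (subst (asm) integrable_completion) auto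
qed

lemma set_integrable_laplace_power:
  assumes "Re s > 0" "Re z > 0"
  shows "set_integrable lborel {0<..} (\<lambda>t. complex_of_real t powr (s - 1) * exp (- (z * of_real t)))"
proof -
  \<comment> \<open>On \<open>{0<..}\<close> the complex power equals
    \<open>exp ((s - 1) * ln t)\<close>, a form whose measurability is immediate. The same rewriting
    recurs wherever a power has to be measurable.\<close>
  have "set_integrable lborel {0<..} (\<lambda>t. exp ((s - 1) * of_real (ln t)) * exp (- (z * of_real t)))"
  proof (rule set_integrable_bound[OF set_integrable_powr_exp[of "Re s - 1" "Re z"]])
    show "AE t in lborel. t \<in> {0<..} \<longrightarrow>
        norm (exp ((s - 1) * of_real (ln t)) * exp (- (z * of_real t)))
        \<le> norm (t powr (Re s - 1) * exp (- (Re z * t)))"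
      by (auto simp: norm_mult powr_def mult.commute)
  qed (use assms in \<open>auto simp: set_borel_measurable_def\<close>)
  then show ?thesis
    by (rule set_integrable_cong[THEN iffD1, rotated -1]) (auto simp: powr_eq_exp_ln)
qed

text \<open>The substitution of \<open>r * t\<close> for \<open>t\<close> in Euler's integral. Such
  real points serve as centres of expansion for complex \<open>z\<close>.\<close>

lemma laplace_power_real:
  assumes "Re s > 0" "r > 0"
  shows "(LINT t:{0<..}|lborel. complex_of_real t powr (s - 1) * exp (- (of_real r * of_real t)))
           = Gamma s * of_real r powr (- s)"
proof -
  define f where "f = (\<lambda>t. indicator {0<..} t *\<^sub>R (complex_of_real t powr (s - 1) * exp (- of_real t)))"
  have eq: "complex_of_real t powr (s - 1) * exp (- of_real t) = of_real t powr (s - 1) / of_real (exp t)" for t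
    by (simp add: exp_minus field_simps exp_of_real)
  have "set_integrable lborel {0<..} (\<lambda>t. complex_of_real t powr (s - 1) * exp (- of_real t))"
    using set_integrable_laplace_power[of s 1] assms by simp
  then have "integral\<^sup>L lborel f = integral {0<..} (\<lambda>t. complex_of_real t powr (s - 1) / of_real (exp t))"
    unfolding f_def by (subst set_borel_integral_eq_integral(2)[symmetric])
                       (simp_all add: set_lebesgue_integral_def eq)
  also have "\<dots> = Gamma s"
    using Gamma_integral_complex'[OF assms(1)] by (rule integral_unique)
  finally have G: "Gamma s = r *\<^sub>R (\<integral>t. f (r * t) \<partial>lborel)"
    using lborel_integral_real_affine[of r f 0] assms by simp
  have "f (r * t) = of_real r powr (s - 1) *
          (indicator {0<..} t *\<^sub>R (complex_of_real t powr (s - 1) * exp (- (of_real r * of_real t))))" for t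
    using assms by (auto simp: f_def indicator_def powr_times_real zero_less_mult_iff)
  then have "Gamma s = of_real r * (of_real r powr (s - 1)) *
       (LINT t:{0<..}|lborel. complex_of_real t powr (s - 1) * exp (- (of_real r * of_real t)))"
    unfolding G by (simp add: set_lebesgue_integral_def scaleR_conv_of_real)
  also have "of_real r * (of_real r powr (s - 1)) = complex_of_real r powr s"
    using assms by (simp add: powr_diff)
  finally show ?thesis
    using assms by (simp add: powr_minus field_simps)
qed

text \<open>Reduction to real \<open>z\<close>: the factor \<open>exp (- (z - r) t)\<close> is expanded in powers of
  \<open>z - r\<close>. The point \<open>r = |z|\<^sup>2 / Re z\<close> is far enough to the right to have
  \<open>|z - r| < r\<close>, and the integrated series is the binomial series of \<open>(1 + (z - r) / r) powr (- s)\<close>.\<close>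

lemma laplace_power:
  assumes s: "Re s > 0" and z: "Re z > 0"
  shows "(LINT t:{0<..}|lborel. complex_of_real t powr (s - 1) * exp (- (z * of_real t)))
           = Gamma s * z powr (- s)"
proof -
  define r where "r = (norm z)\<^sup>2 / Re z"
  define w where "w = z - of_real r"
  have z0: "z \<noteq> 0" using z by auto
  have r: "r > 0" using z z0 by (simp add: r_def)
  have "(norm w)\<^sup>2 = (norm z)\<^sup>2 - 2 * (r * Re z) + r\<^sup>2"
    by (simp add: w_def cmod_power2) algebra
  moreover have "r * Re z = (norm z)\<^sup>2" using z by (simp add: r_def)
  ultimately have "(norm w)\<^sup>2 < r\<^sup>2" using z0 by simp
  then have w: "norm w < r" using r by (simp add: power2_less_imp_less)
  \<comment> \<open>\<open>S N\<close> is the integrand with the series of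
    \<open>exp (- w * t)\<close> cut off after \<open>N\<close> terms. Each \<open>t ^ k\<close> is
    absorbed into the power of \<open>t\<close>, so every term is a Laplace integral at the real
    point \<open>r\<close> with \<open>s + k\<close> for \<open>s\<close>.\<close>
  define S where "S = (\<lambda>N t. \<Sum>k<N. ((- w) ^ k / fact k) *
      (indicator {0<..} t *\<^sub>R (complex_of_real t powr (s + of_nat k - 1) * exp (- (of_real r * of_real t)))))"
  \<comment> \<open>Every partial sum of the exponential series is at most
    \<open>exp (norm w * t)\<close>, which leaves the positive decay rate
    \<open>r - norm w\<close>.\<close>
  let ?B = "\<lambda>t. indicator {0<..} t *\<^sub>R (t powr (Re s - 1) * exp (- ((r - norm w) * t)))"
  let ?F = "\<lambda>t. indicator {0<..} t *\<^sub>R (complex_of_real t powr (s - 1) * exp (- (z * of_real t)))"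
  have S_eq: "S N t = indicator {0<..} t *\<^sub>R (complex_of_real t powr (s - 1) * exp (- (of_real r * of_real t)) *
      (\<Sum>k<N. (- w * of_real t) ^ k / fact k))" for N t
  proof (cases "t > 0")
    case True
    have "complex_of_real t powr (s + of_nat k - 1) = complex_of_real t powr (s - 1) * of_real t ^ k" for k
      using True powr_add[of "complex_of_real t" "s - 1" "of_nat k"]
      by (simp add: algebra_simps powr_nat)
    moreover have "(- (w * of_real t)) ^ k = (- w) ^ k * of_real t ^ k" for k
      by (simp add: power_mult_distrib[symmetric])
    ultimately show ?thesis
      using True by (simp add: S_def sum_distrib_left mult_ac lessThan_def)
  qed (simp add: S_def)
  have int: "set_integrable lborel {0<..} (\<lambda>t. complex_of_real t powr (s + of_nat k - 1) * exp (- (of_real r * of_real t)))" for k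
    using set_integrable_laplace_power[of "s + of_nat k" "of_real r"] s r by simp
  have lim: "(\<lambda>N. integral\<^sup>L lborel (S N)) \<longlonglongrightarrow> integral\<^sup>L lborel ?F"
  proof (rule integral_dominated_convergence[where w = ?B])
    show "?F \<in> borel_measurable lborel"
      using set_integrable_laplace_power[OF s z] by (simp add: set_integrable_def)
    show "S N \<in> borel_measurable lborel" for N
      unfolding S_def using int[unfolded set_integrable_def, THEN borel_measurable_integrable]
      by (intro borel_measurable_sum borel_measurable_times) auto
    show "integrable lborel ?B"
      using set_integrable_powr_exp[of "Re s - 1" "r - norm w"] s w by (simp add: set_integrable_def)
    show "AE t in lborel. (\<lambda>N. S N t) \<longlonglongrightarrow> ?F t"
    proof (rule AE_I2)
      fix t
      have "(\<lambda>N. \<Sum>k<N. (- w * of_real t) ^ k / fact k) \<longlonglongrightarrow> exp (- w * of_real t)"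
        using exp_converges[of "- w * of_real t"]
        by (simp add: sums_def scaleR_conv_of_real field_simps)
      then have "(\<lambda>N. S N t) \<longlonglongrightarrow> indicator {0<..} t *\<^sub>R (complex_of_real t powr (s - 1) *
           exp (- (of_real r * of_real t)) * exp (- w * of_real t))"
        unfolding S_eq by (intro tendsto_intros)
      also have "complex_of_real t powr (s - 1) * exp (- (of_real r * of_real t)) * exp (- w * of_real t)
          = complex_of_real t powr (s - 1) * exp (- (z * of_real t))"
        by (simp add: w_def mult.assoc exp_add[symmetric] algebra_simps)
      finally show "(\<lambda>N. S N t) \<longlonglongrightarrow> ?F t" .
    qed
    show "AE t in lborel. norm (S N t) \<le> ?B t" for N
    proof (rule AE_I2)
      fix t :: real
      show "norm (S N t) \<le> ?B t"
      proof (cases "t > 0")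
        case True
        have "norm (\<Sum>k<N. (- w * of_real t) ^ k / fact k) \<le> (\<Sum>k<N. (norm w * t) ^ k / fact k)"
          using True by (intro order.trans[OF norm_sum] sum_mono)
                        (simp add: norm_divide norm_power norm_mult)
        also have "\<dots> \<le> exp (norm w * t)"
          using True exp_converges[of "norm w * t"] 
          by (intro sum_le_suminf[THEN order.trans])
             (auto simp: sums_iff scaleR_conv_of_real field_simps)
        finally have "norm (S N t) \<le> t powr (Re s - 1) * exp (- (r * t)) * exp (norm w * t)"
          using True unfolding S_eq by (auto simp: norm_mult norm_powr_real_powr intro!: mult_left_mono)
        also have "\<dots> = t powr (Re s - 1) * exp (- ((r - norm w) * t))"
          by (simp add: mult.assoc exp_add[symmetric] algebra_simps)
        finally show ?thesis using True by simp
      qed (simp add: S_def)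
    qed
  qed
  have wr: "norm (w / of_real r) < 1" using w r by (simp add: norm_divide)
  have "integral\<^sup>L lborel (S N) = Gamma s * of_real r powr (- s) *
          (\<Sum>k<N. ((- s) gchoose k) * (w / of_real r) ^ k)" for N
  proof -
    have "integral\<^sup>L lborel (S N) = (\<Sum>k<N. ((- w) ^ k / fact k) *
        (LINT t:{0<..}|lborel. complex_of_real t powr (s + of_nat k - 1) * exp (- (of_real r * of_real t))))"
      unfolding S_def set_lebesgue_integral_def
      by (subst Bochner_Integration.integral_sum)
         (intro integrable_mult_right int[unfolded set_integrable_def],
          simp only: integral_mult_right_zero)
    also have "\<dots> = (\<Sum>k<N. ((- w) ^ k / fact k) * (Gamma (s + of_nat k) * of_real r powr (- s - of_nat k)))"
      using s r by (subst laplace_power_real) auto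
    also have "\<dots> = (\<Sum>k<N. Gamma s * of_real r powr (- s) * (((- s) gchoose k) * (w / of_real r) ^ k))"
    proof (rule sum.cong)
      fix k
      \<comment> \<open>The quotient \<open>Gamma (s + k) / Gamma s\<close> is a rising factorial,
        and dividing it by \<open>(-1) ^ k * fact k\<close> yields the binomial coefficient of
        \<open>- s\<close>.\<close>
      have ns: "s \<notin> \<int>\<^sub>\<le>\<^sub>0" using s by (auto elim!: nonpos_Ints_cases)
      then have "Gamma (s + of_nat k) = Gamma s * pochhammer s k"
        by (subst pochhammer_Gamma) (auto simp: Gamma_eq_zero_iff)
      moreover have "of_real r powr (- s - of_nat k) = of_real r powr (- s) / complex_of_real r ^ k"
        using r by (simp add: powr_diff powr_nat)
      moreover have "(- w) ^ k = (-1) ^ k * w ^ k" by (rule power_minus)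
      ultimately show "((- w) ^ k / fact k) * (Gamma (s + of_nat k) * of_real r powr (- s - of_nat k)) =
         Gamma s * of_real r powr (- s) * (((- s) gchoose k) * (w / of_real r) ^ k)"
        by (simp add: gbinomial_pochhammer power_divide)
    qed simp
    finally show ?thesis by (simp add: sum_distrib_left)
  qed
  moreover have "(\<lambda>N. \<Sum>k<N. ((- s) gchoose k) * (w / of_real r) ^ k) \<longlonglongrightarrow> (1 + w / of_real r) powr (- s)"
    using gen_binomial_complex[OF wr, of "- s"] by (simp add: sums_def)
  ultimately have "(\<lambda>N. integral\<^sup>L lborel (S N)) \<longlonglongrightarrow>
      Gamma s * of_real r powr (- s) * (1 + w / of_real r) powr (- s)"
    by (simp add: tendsto_mult_left)
  with lim have "integral\<^sup>L lborel ?F = Gamma s * of_real r powr (- s) * (1 + w / of_real r) powr (- s)"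
    by (rule LIMSEQ_unique)
  also have "\<dots> = Gamma s * (of_real r powr (- s) * (z / of_real r) powr (- s))"
    using r by (simp add: w_def diff_divide_distrib)
  also have "complex_of_real r powr (- s) * (z / of_real r) powr (- s) = z powr (- s)"
  proof -
    \<comment> \<open>A positive real factor does not change the argument, so the principal powers
      multiply without a branch correction.\<close>
    have "Ln z = Ln (of_real r * (z / of_real r))" using r by simp
    also have "\<dots> = of_real (ln r) + Ln (z / of_real r)"
      using r z0 by (subst Ln_times_of_real) (auto simp: Ln_of_real)
    finally show ?thesis
      using r z0 by (simp add: powr_def exp_add[symmetric] Ln_of_real algebra_simps)
  qed
  finally show ?thesis by (simp add: set_lebesgue_integral_def mult.assoc)
qed

section \<open>Bounds for the Gamma function on vertical lines\<close>

lemma norm_powr_complex: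
  assumes "z \<noteq> 0"
  shows "norm (z powr s) = norm z powr Re s * exp (- (Im s * Im (Ln z)))"
  using assms by (simp add: powr_def exp_diff exp_minus field_simps)

text \<open>Taking absolute values inside the Laplace integral replaces \<open>s\<close> and
  \<open>z\<close> by their real parts. The freedom in \<open>z\<close> is the point:
  \<open>z = 1\<close> gives a plain bound, while \<open>z\<close> close to the imaginary axis
  extracts exponential decay of Gamma.\<close>

lemma norm_Gamma_times_powr_le:
  assumes s: "Re s > 0" and z: "Re z > 0"
  shows "norm (Gamma s * z powr (- s)) \<le> norm (Gamma (complex_of_real (Re s))) * Re z powr (- Re s)"
proof -
  let ?f = "\<lambda>t. indicator {0<..} t *\<^sub>R (complex_of_real t powr (s - 1) * exp (- (z * of_real t)))"
  let ?g = "\<lambda>t. indicator {0<..} t *\<^sub>R (complex_of_real t powr (complex_of_real (Re s) - 1) * exp (- (of_real (Re z) * of_real t)))"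
  have eq: "complex_of_real (norm (?f t)) = ?g t" for t
    by (auto simp: indicator_def norm_mult norm_powr_real_powr powr_of_real[symmetric] exp_of_real[symmetric])
  have "norm (integral\<^sup>L lborel ?f) \<le> (\<integral>t. norm (?f t) \<partial>lborel)"
    by (rule integral_norm_bound)
  also have "\<dots> \<le> norm (complex_of_real (\<integral>t. norm (?f t) \<partial>lborel))"
    by simp
  also have "complex_of_real (\<integral>t. norm (?f t) \<partial>lborel) = integral\<^sup>L lborel ?g"
    unfolding integral_complex_of_real[symmetric] eq ..
  finally have "norm (LINT t:{0<..}|lborel. complex_of_real t powr (s - 1) * exp (- (z * of_real t)))
      \<le> norm (LINT t:{0<..}|lborel. complex_of_real t powr (complex_of_real (Re s) - 1) * exp (- (of_real (Re z) * of_real t)))"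
    by (simp add: set_lebesgue_integral_def)
  then show ?thesis
    using s z by (simp add: laplace_power laplace_power_real norm_mult norm_powr_real_powr)
qed

lemma arctan_le_self:
  fixes x :: real
  assumes "x \<ge> 0"
  shows "arctan x \<le> x"
proof -
  have "0 - arctan 0 \<le> x - arctan x"
  proof (rule DERIV_nonneg_imp_nondecreasing[OF assms])
    fix u :: real
    have "((\<lambda>u. u - arctan u) has_real_derivative 1 - inverse (1 + u\<^sup>2)) (at u)"
      by (auto intro!: derivative_eq_intros)
    moreover have "inverse (1 + u\<^sup>2) \<le> 1" by (rule inverse_le_1_iff[THEN iffD2]) auto
    ultimately show "\<exists>y. ((\<lambda>u. u - arctan u) has_real_derivative y) (at u) \<and> 0 \<le> y"
      by force
  qed
  then show ?thesis by simp
qed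

text \<open>The weight \<open>exp (pi / 2 * |b|)\<close> is the largest size that the
  \<open>ee\<close> factors, and powers of \<open>z\<close> in the right half-plane with
  \<open>norm z\<close> at least 1, can reach. The exact exponent from Stirling's formula is
  immaterial, because the kernels \<open>K\<close> decay faster than any polynomial.\<close>

lemma Gamma_vertical_bound:
  assumes a: "a > 0"
  obtains C N where "C \<ge> 0" "\<And>b. norm (Gamma (Complex a b)) * exp (pi / 2 * \<bar>b\<bar>) \<le> C * (1 + b\<^sup>2) ^ N"
proof -
  define N where "N = nat \<lceil>a\<rceil>"
  define G where "G = norm (Gamma (complex_of_real a))"
  \<comment> \<open>The first summand serves \<open>|b| < 1\<close>, the second the other
    \<open>b\<close>: there \<open>2 powr a\<close> pays for \<open>norm z \<le> 2\<close>, and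
    \<open>exp 1\<close> for a loss of at most 1 in the exponent
    \<open>b * Im (Ln z)\<close>.\<close>
  define C where "C = G * exp (pi / 2) + G * 2 powr a * exp 1"
  have G: "G \<ge> 0" by (simp add: G_def)
  have "norm (Gamma (Complex a b)) * exp (pi / 2 * \<bar>b\<bar>) \<le> C * (1 + b\<^sup>2) ^ N" for b
  proof (cases "\<bar>b\<bar> \<ge> 1")
    case False
    have "norm (Gamma (Complex a b)) \<le> G"
      using norm_Gamma_times_powr_le[of "Complex a b" 1] a by (simp add: G_def)
    then have "norm (Gamma (Complex a b)) * exp (pi / 2 * \<bar>b\<bar>) \<le> G * exp (pi / 2)"
      using False G by (intro mult_mono) auto
    also have "\<dots> \<le> C * 1" using G by (simp add: C_def)
    also have "\<dots> \<le> C * (1 + b\<^sup>2) ^ N"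
      using G by (intro mult_left_mono one_le_power) (auto simp: C_def)
    finally show ?thesis .
  next
    case True
    \<comment> \<open>Turning the ray of integration almost onto the imaginary axis gains
      \<open>exp (- pi |b| / 2)\<close>; the remaining distance \<open>1 / |b|\<close> costs only a power of \<open>|b|\<close>.\<close>
    define z where "z = Complex (1 / \<bar>b\<bar>) (sgn b)"
    have z: "Re z > 0" "z \<noteq> 0" "norm z \<le> 2"
    proof -
      show "Re z > 0" using True by (simp add: z_def)
      then show "z \<noteq> 0" by auto
      have "norm z \<le> \<bar>Re z\<bar> + \<bar>Im z\<bar>" by (rule cmod_le)
      also have "\<dots> \<le> 2" using True by (simp add: z_def abs_sgn_eq)
      finally show "norm z \<le> 2" .
    qed
    have "Im z / Re z = b" by (simp add: z_def sgn_mult_abs)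
    then have "Im (Ln z) = arctan b"
      using z arg_conv_arctan[of z] Arg_eq_Im_Ln[of z] by simp
    then have "b * Im (Ln z) = \<bar>b\<bar> * arctan \<bar>b\<bar>"
      by (simp add: abs_if arctan_minus)
    moreover have "arctan \<bar>b\<bar> = pi / 2 - arctan (1 / \<bar>b\<bar>)"
      using True arctan_inverse[of "\<bar>b\<bar>"] by (simp add: inverse_eq_divide)
    moreover have "arctan (1 / \<bar>b\<bar>) \<le> 1 / \<bar>b\<bar>"
      by (rule arctan_le_self) simp
    then have "\<bar>b\<bar> * arctan (1 / \<bar>b\<bar>) \<le> 1"
      using True by (simp add: field_simps)
    ultimately have arg: "b * Im (Ln z) \<ge> pi / 2 * \<bar>b\<bar> - 1"
      by (simp add: algebra_simps)
    have "Re z powr (- a) = \<bar>b\<bar> powr a"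
      using True by (simp add: z_def powr_divide powr_minus)
    also have "\<dots> \<le> \<bar>b\<bar> powr (real N)"
      using True a by (intro powr_mono) (auto simp: N_def)
    also have "\<dots> = \<bar>b\<bar> ^ N" using True by (subst powr_realpow) auto
    also have "\<dots> \<le> (1 + b\<^sup>2) ^ N"
      using True self_le_power[of "\<bar>b\<bar>" 2] by (intro power_mono) auto
    finally have pw: "Re z powr (- a) \<le> (1 + b\<^sup>2) ^ N" .
    have "1 \<le> 2 powr a * norm z powr (- a)"
      using z a powr_mono2[of a "norm z" 2] by (simp add: powr_minus field_simps)
    moreover have "exp (pi / 2 * \<bar>b\<bar>) \<le> exp 1 * exp (b * Im (Ln z))"
      using arg by (simp add: exp_add[symmetric])
    ultimately have "1 * exp (pi / 2 * \<bar>b\<bar>) \<le> (2 powr a * norm z powr (- a)) * (exp 1 * exp (b * Im (Ln z)))"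
      by (intro mult_mono) auto
    then have "norm (Gamma (Complex a b)) * exp (pi / 2 * \<bar>b\<bar>) \<le> norm (Gamma (Complex a b)) *
                ((2 powr a * norm z powr (- a)) * (exp 1 * exp (b * Im (Ln z))))"
      by (intro mult_left_mono) auto
    also have "\<dots> = norm (Gamma (Complex a b) * z powr (- Complex a b)) * (2 powr a * exp 1)"
      using z by (simp add: norm_mult norm_powr_complex)
    also have "\<dots> \<le> (G * Re z powr (- a)) * (2 powr a * exp 1)"
      using norm_Gamma_times_powr_le[of "Complex a b" z] a z
      by (intro mult_right_mono) (auto simp: G_def)
    also have "\<dots> \<le> (G * (1 + b\<^sup>2) ^ N) * (2 powr a * exp 1)"
      using pw G by (intro mult_right_mono mult_left_mono) auto
    also have "\<dots> \<le> C * (1 + b\<^sup>2) ^ N"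
      using G by (simp add: C_def algebra_simps)
    finally show ?thesis .
  qed
  moreover have "C \<ge> 0" using G by (simp add: C_def)
  ultimately show ?thesis by (rule that[rotated])
qed

subsection \<open>Inverse Mellin integrals\<close>

lemma borel_measurable_Complex [measurable]:
  assumes [measurable]: "f \<in> borel_measurable M" "g \<in> borel_measurable M"
  shows "(\<lambda>x. Complex (f x) (g x)) \<in> borel_measurable M"
  unfolding Complex_eq by measurable

lemma integrable_lborel_if_quadratic_decay:
  fixes f :: "real \<Rightarrow> complex"
  assumes [measurable]: "f \<in> borel_measurable borel" and le: "\<And>t. norm (f t) * (1 + t\<^sup>2) \<le> C"
  shows "integrable lborel f"
proof (rule Bochner_Integration.integrable_bound)
  show "integrable lborel (\<lambda>t::real. C * inverse (1 + t\<^sup>2))"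
    using integrable_inverse_1_plus_square by (simp add: set_integrable_def)
  have "norm (f t) \<le> norm (C * inverse (1 + t\<^sup>2))" for t
  proof -
    have "1 + t\<^sup>2 > 0" by (simp add: add_pos_nonneg)
    with le[of t] have "norm (f t) \<le> C * inverse (1 + t\<^sup>2)" by (simp add: field_simps)
    then show ?thesis by simp
  qed
  then show "AE t in lborel. norm (f t) \<le> norm (C * inverse (1 + t\<^sup>2))" by simp
qed simp

text \<open>The constant bound is used up to 1 and the power bound from 1 onwards.\<close>

lemma set_integrable_pos_if_bounds:
  fixes h :: "real \<Rightarrow> complex"
  assumes meas: "set_borel_measurable borel {0<..} h" and q: "q < -1"
    and A: "\<And>t. t > 0 \<Longrightarrow> norm (h t) \<le> A" and B: "\<And>t. t > 0 \<Longrightarrow> norm (h t) \<le> B * t powr q"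
  shows "set_integrable lborel {0<..} h"
proof -
  have "set_integrable lebesgue {1..} (\<lambda>t::real. t powr q)"
    using has_integral_powr_to_inf[OF q, of 1]
    by (intro nonnegative_absolutely_integrable_1) (auto simp: integrable_on_def)
  then have [simp]: "integrable lborel (\<lambda>t::real. indicator {1..} t * t powr q)"
    unfolding set_integrable_def by (subst (asm) integrable_completion) auto
  have [simp]: "integrable lborel (indicator {0<..1::real} :: real \<Rightarrow> real)"
    by (intro integrable_real_indicator) auto
  show ?thesis unfolding set_integrable_def
  proof (rule Bochner_Integration.integrable_bound)
    show "integrable lborel (\<lambda>t::real. A * indicator {0<..1} t + B * (indicator {1..} t * t powr q))"
      by (intro Bochner_Integration.integrable_add integrable_mult_right) auto
    have "A \<ge> 0" "B \<ge> 0"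
      using A[of 1] B[of 1] by (auto intro: order.trans[OF norm_ge_zero])
    then have "norm (indicator {0<..} t *\<^sub>R h t) \<le> A * indicator {0<..1} t + B * (indicator {1..} t * t powr q)" for t
      using A[of t] B[of t] by (auto simp: indicator_def)
    then show "AE t in lborel. norm (indicator {0<..} t *\<^sub>R h t)
        \<le> norm (A * indicator {0<..1} t + B * (indicator {1..} t * t powr q))"
      by (intro AE_I2) (smt (verit) real_norm_def)
  qed (use meas in \<open>simp add: set_borel_measurable_def\<close>)
qed

lemma integrable_lborel_pair_if_product_bound:
  fixes F :: "real \<times> real \<Rightarrow> complex"
  assumes F: "F \<in> borel_measurable (lborel \<Otimes>\<^sub>M lborel)"
    and A: "integrable lborel A" and B: "integrable lborel B"
    and le: "\<And>x y. norm (F (x, y)) \<le> A x * B y"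
  shows "integrable (lborel \<Otimes>\<^sub>M lborel) F"
proof (rule Bochner_Integration.integrable_bound[OF _ F])
  have [measurable]: "A \<in> borel_measurable borel" "B \<in> borel_measurable borel"
    using A B by auto
  show "integrable (lborel \<Otimes>\<^sub>M lborel) (\<lambda>(x, y). A x * B y :: real)"
    using A B by (intro lborel_pair.Fubini_integrable) (auto simp: abs_mult intro!: integrable_mult_left)
  show "AE p in lborel \<Otimes>\<^sub>M lborel. norm (F p) \<le> norm (case p of (x, y) \<Rightarrow> A x * B y)"
    using le by (intro AE_I2) (auto intro: order.trans[OF _ abs_ge_self])
qed

text \<open>\<open>K s\<close> stands for the Mellin transform of \<open>J\<close> at
  \<open>1 - s\<close>, whence the exponent \<open>s - 1\<close>; it also fits the variable
  \<open>y = 1 / x\<close>. Having all abscissas beyond \<open>c\<close> at once provides different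
  power bounds for \<open>J\<close>, and the rapid decay of \<open>K\<close> can absorb one Gamma
  factor after another.\<close>

definition inverse_mellin_rep :: "real \<Rightarrow> (complex \<Rightarrow> complex) \<Rightarrow> (real \<Rightarrow> complex) \<Rightarrow> bool" where
  "inverse_mellin_rep c K J \<longleftrightarrow> (\<forall>\<sigma>>c.
     (\<lambda>t. K (Complex \<sigma> t)) \<in> borel_measurable borel \<and>
     (\<forall>N. \<exists>C. \<forall>t. norm (K (Complex \<sigma> t)) * (1 + t\<^sup>2) ^ N \<le> C) \<and>
     (\<forall>y>0. J y = (\<integral>t. K (Complex \<sigma> t) * of_real y powr (Complex \<sigma> t - 1) \<partial>lborel) / (2 * pi)))"

context
  fixes c :: real and K :: "complex \<Rightarrow> complex" and J :: "real \<Rightarrow> complex"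
  assumes rep: "inverse_mellin_rep c K J"
begin

lemma inverse_mellin_rep_integrable:
  assumes "\<sigma> > c"
  shows "integrable lborel (\<lambda>t. K (Complex \<sigma> t))"
proof -
  obtain C where "\<And>t. norm (K (Complex \<sigma> t)) * (1 + t\<^sup>2) ^ 1 \<le> C"
    using rep assms unfolding inverse_mellin_rep_def by blast
  with rep assms show ?thesis
    by (intro integrable_lborel_if_quadratic_decay) (auto simp: inverse_mellin_rep_def)
qed

lemma inverse_mellin_rep_bound:
  assumes "\<sigma> > c"
  obtains B where "\<And>y. y > 0 \<Longrightarrow> norm (J y) \<le> B * y powr (\<sigma> - 1)"
proof (rule that[of "(\<integral>t. norm (K (Complex \<sigma> t)) \<partial>lborel) / (2 * pi)"])
  fix y :: real assume y: "y > 0"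
  have "norm (J y) = norm (\<integral>t. K (Complex \<sigma> t) * of_real y powr (Complex \<sigma> t - 1) \<partial>lborel) / (2 * pi)"
    using rep assms y by (simp add: inverse_mellin_rep_def norm_divide norm_mult)
  also have "\<dots> \<le> (\<integral>t. norm (K (Complex \<sigma> t) * of_real y powr (Complex \<sigma> t - 1)) \<partial>lborel) / (2 * pi)"
    by (intro divide_right_mono integral_norm_bound) auto
  also have "\<dots> = (\<integral>t. norm (K (Complex \<sigma> t)) \<partial>lborel) / (2 * pi) * y powr (\<sigma> - 1)"
    using y by (simp add: norm_mult norm_powr_real_powr)
  finally show "norm (J y) \<le> (\<integral>t. norm (K (Complex \<sigma> t)) \<partial>lborel) / (2 * pi) * y powr (\<sigma> - 1)" .
qed

lemma inverse_mellin_rep_measurable: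
  "set_borel_measurable borel {0<..} J"
proof -
  define \<sigma> where "\<sigma> = c + 1"
  have [measurable]: "(\<lambda>t. K (Complex \<sigma> t)) \<in> borel_measurable borel"
    using rep by (simp add: inverse_mellin_rep_def \<sigma>_def)
  have "(\<lambda>y. indicator {0<..} y *\<^sub>R J y) = (\<lambda>y. indicator {0<..} y *\<^sub>R
      ((\<integral>t. K (Complex \<sigma> t) * exp ((Complex \<sigma> t - 1) * of_real (ln y)) \<partial>lborel) / (2 * pi)))"
    using rep by (auto simp: fun_eq_iff inverse_mellin_rep_def \<sigma>_def indicator_def powr_eq_exp_ln)
  also have "\<dots> \<in> borel_measurable borel" by measurable
  finally show ?thesis by (simp add: set_borel_measurable_def)
qed

text \<open>The representation on \<open>Re s = Re lam + 1\<close> controls the integrand near \<open>0\<close>; the one on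
  a line strictly between \<open>c\<close> and \<open>Re lam\<close> controls it at infinity. This is where the ordering
  of the real parts of the \<open>\<lambda>\<^sub>l\<close> enters.\<close>

lemma inverse_mellin_rep_set_integrable:
  assumes lam: "c < Re lam" and y: "y > 0"
  shows "set_integrable lborel {0<..} (\<lambda>t. of_real t powr (- lam) * J (y * t))"
proof -
  define q where "q = (c + Re lam) / 2"
  obtain A where A: "\<And>y. y > 0 \<Longrightarrow> norm (J y) \<le> A * y powr (Re lam + 1 - 1)"
    using lam by (rule_tac inverse_mellin_rep_bound[of "Re lam + 1"]) auto
  obtain B where B: "\<And>y. y > 0 \<Longrightarrow> norm (J y) \<le> B * y powr (q - 1)"
    using lam by (rule_tac inverse_mellin_rep_bound[of q]) (auto simp: q_def)
  show ?thesis
  proof (rule set_integrable_pos_if_bounds)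
    have [measurable]: "(\<lambda>u. indicator {0<..} u *\<^sub>R J u) \<in> borel_measurable borel"
      using inverse_mellin_rep_measurable by (simp add: set_borel_measurable_def)
    have "(\<lambda>t. indicator {0<..} t *\<^sub>R (of_real t powr (- lam) * J (y * t))) =
        (\<lambda>t. exp (- lam * of_real (ln t)) * (indicator {0<..} (y * t) *\<^sub>R J (y * t)))"
      using y by (auto simp: fun_eq_iff indicator_def powr_eq_exp_ln zero_less_mult_iff)
    also have "\<dots> \<in> borel_measurable borel" by measurable
    finally show "set_borel_measurable borel {0<..} (\<lambda>t. of_real t powr (- lam) * J (y * t))"
      by (simp add: set_borel_measurable_def)
    show "q - 1 - Re lam < -1" using lam by (simp add: q_def)
    fix t :: real assume t: "t > 0"
    have n: "norm (of_real t powr (- lam) * J (y * t)) = t powr (- Re lam) * norm (J (y * t))"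
      using t by (simp add: norm_mult norm_powr_real_powr)
    have "t powr (- Re lam) * norm (J (y * t)) \<le> t powr (- Re lam) * (A * (y * t) powr (Re lam))"
      using A[of "y * t"] t y by (intro mult_left_mono) auto
    also have "\<dots> = A * y powr Re lam"
      using t y by (simp add: powr_mult powr_minus field_simps)
    finally show "norm (of_real t powr (- lam) * J (y * t)) \<le> A * y powr Re lam"
      unfolding n .
    have "t powr (- Re lam) * norm (J (y * t)) \<le> t powr (- Re lam) * (B * (y * t) powr (q - 1))"
      using B[of "y * t"] t y by (intro mult_left_mono) auto
    also have "\<dots> = B * y powr (q - 1) * t powr (q - 1 - Re lam)"
    proof -
      have "t powr (q - 1 - Re lam) = t powr (- Re lam) * t powr (q - 1)"
        by (simp add: powr_add[symmetric])
      then show ?thesis using t y by (simp add: powr_mult)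
    qed
    finally show "norm (of_real t powr (- lam) * J (y * t)) \<le> B * y powr (q - 1) * t powr (q - 1 - Re lam)"
      unfolding n .
  qed
qed

end

subsection \<open>Oscillatory multiplicative convolution\<close>

text \<open>Moves the Gamma bound, which is centred at \<open>Im lam\<close>, to the weight
  \<open>1 + t\<^sup>2\<close> of \<open>inverse_mellin_rep\<close>.\<close>

lemma one_plus_diff_square_le:
  "1 + (t - b)\<^sup>2 \<le> 2 * (1 + b\<^sup>2) * (1 + t\<^sup>2)" for t b :: real
proof -
  have "2 * (1 + b\<^sup>2) * (1 + t\<^sup>2) - (1 + (t - b)\<^sup>2) = 1 + (t + b)\<^sup>2 + 2 * (b * t)\<^sup>2"
    by (simp add: power2_eq_square algebra_simps)
  moreover have "1 + (t + b)\<^sup>2 + 2 * (b * t)\<^sup>2 \<ge> 0" by (simp add: add_nonneg_nonneg)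
  ultimately show ?thesis by linarith
qed

text \<open>The principal argument of \<open>- sg * \<i>\<close> is \<open>- sg * pi / 2\<close>.
  Hence the factor \<open>z powr (- w)\<close> of the damped integral tends to exactly the
  exponential factor of \<open>gamma_product\<close>.\<close>

lemma powr_minus_imaginary_unit:
  assumes "sg \<in> {1, -1 :: real}"
  shows "(- (of_real sg * \<i>)) powr (- w) = ee (of_real sg * w / 4)"
  using assms by (auto simp: powr_def ee_def field_simps)

lemma norm_ee:
  "norm (ee (of_real sg * w / 4)) = exp (- (pi / 2 * (sg * Im w)))"
  by (simp add: ee_def)

lemma borel_measurable_Gamma_vertical:
  assumes "\<sigma> > Re w"
  shows "(\<lambda>t. Gamma (Complex \<sigma> t - w)) \<in> borel_measurable borel"
proof (rule borel_measurable_continuous_onI)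
  have "continuous_on {z. Re z > 0} (Gamma :: complex \<Rightarrow> complex)"
    by (rule continuous_on_Gamma) (auto elim!: nonpos_Ints_cases)
  then show "continuous_on UNIV (\<lambda>t. Gamma (Complex \<sigma> t - w))"
  proof (rule continuous_on_compose2)
    show "continuous_on UNIV (\<lambda>t. Complex \<sigma> t - w)"
      unfolding Complex_eq by (intro continuous_intros)
  qed (use assms in auto)
qed

context
  fixes c :: real and K :: "complex \<Rightarrow> complex" and J :: "real \<Rightarrow> complex" and sg :: real and lam :: complex
  assumes rep: "inverse_mellin_rep c K J" and lam: "c < Re lam" and sg: "sg \<in> {1, -1}"
begin

lemma oscillatory_set_integrable:
  assumes "y > 0"
  shows "set_integrable lborel {0<..} (\<lambda>t. of_real t powr (- lam) * exp (of_real sg * \<i> * of_real t) * J (y * t))"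
proof -
  have "set_integrable lborel {0<..} (\<lambda>t. exp (of_real sg * \<i> * of_real t) * (of_real t powr (- lam) * J (y * t)))"
  proof (rule set_integrable_bound[OF inverse_mellin_rep_set_integrable[OF rep lam assms]])
    have [measurable]: "(\<lambda>t. indicator {0<..} t *\<^sub>R (of_real t powr (- lam) * J (y * t))) \<in> borel_measurable lborel"
      using inverse_mellin_rep_set_integrable[OF rep lam assms] by (auto simp: set_integrable_def)
    have "(\<lambda>t. exp (of_real sg * \<i> * of_real t) * (indicator {0<..} t *\<^sub>R (of_real t powr (- lam) * J (y * t))))
        \<in> borel_measurable lborel" by measurable
    then show "set_borel_measurable lborel {0<..}
         (\<lambda>t. exp (of_real sg * \<i> * of_real t) * (of_real t powr (- lam) * J (y * t)))"
      by (simp add: set_borel_measurable_def)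
  qed (auto simp: norm_mult)
  then show ?thesis by (simp add: mult_ac)
qed

text \<open>Inserting the representation of \<open>J\<close> on the line at \<open>\<sigma>\<close>
  produces \<open>t powr (\<sigma> - Re lam - 1)\<close>, which is integrable at 0 but not at
  infinity. The damping by \<open>Re z > 0\<close> makes the double integral absolutely convergent,
  so that Fubini applies and the inner integral is a Gamma factor.\<close>

lemma damped_oscillatory_integral:
  assumes y: "y > 0" and \<sigma>: "\<sigma> > Re lam" and z: "Re z > 0"
  shows "(LINT t:{0<..}|lborel. of_real t powr (- lam) * exp (- (z * of_real t)) * J (y * t)) =
     (\<integral>t. K (Complex \<sigma> t) * of_real y powr (Complex \<sigma> t - 1) *
           (Gamma (Complex \<sigma> t - lam) * z powr (- (Complex \<sigma> t - lam))) \<partial>lborel) / (2 * pi)"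
proof -
  define k where "k = (\<lambda>\<tau>. K (Complex \<sigma> \<tau>) * of_real y powr (Complex \<sigma> \<tau> - 1))"
  define F where "F = (\<lambda>t \<tau>. indicator {0<..} t *\<^sub>R
      (k \<tau> * (exp ((Complex \<sigma> \<tau> - lam - 1) * of_real (ln t)) * exp (- (z * of_real t)))))"
  have c: "\<sigma> > c" using \<sigma> lam by simp
  have [measurable]: "(\<lambda>t. K (Complex \<sigma> t)) \<in> borel_measurable borel"
    using rep c by (simp add: inverse_mellin_rep_def)
  have k_eq: "k = (\<lambda>\<tau>. K (Complex \<sigma> \<tau>) * exp ((Complex \<sigma> \<tau> - 1) * of_real (ln y)))"
    using y by (simp add: k_def powr_eq_exp_ln)
  have [measurable]: "k \<in> borel_measurable borel" unfolding k_eq by measurable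
  have int_k: "integrable lborel k"
  proof (rule Bochner_Integration.integrable_bound)
    show "integrable lborel (\<lambda>t. of_real (y powr (\<sigma> - 1)) * K (Complex \<sigma> t))"
      using inverse_mellin_rep_integrable[OF rep c] by simp
    show "AE t in lborel. norm (k t) \<le> norm (of_real (y powr (\<sigma> - 1)) * K (Complex \<sigma> t))"
      using y by (simp add: k_def norm_mult norm_powr_real_powr)
  qed simp
  have int: "integrable (lborel \<Otimes>\<^sub>M lborel) (case_prod F)"
  proof (rule integrable_lborel_pair_if_product_bound)
    show "case_prod F \<in> borel_measurable (lborel \<Otimes>\<^sub>M lborel)" unfolding F_def by measurable
    show "integrable lborel (\<lambda>t. indicator {0<..} t *\<^sub>R (t powr (\<sigma> - Re lam - 1) * exp (- (Re z * t))))"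
      using set_integrable_powr_exp[of "\<sigma> - Re lam - 1" "Re z"] \<sigma> z by (simp add: set_integrable_def)
    show "integrable lborel (\<lambda>\<tau>. norm (k \<tau>))" using int_k by simp
    show "norm (case (t, \<tau>) of (t, \<tau>) \<Rightarrow> F t \<tau>)
        \<le> indicator {0<..} t *\<^sub>R (t powr (\<sigma> - Re lam - 1) * exp (- (Re z * t))) * norm (k \<tau>)" for t \<tau>
      by (auto simp: F_def norm_mult indicator_def powr_def mult_ac)
  qed
  have "indicator {0<..} t *\<^sub>R (of_real t powr (- lam) * exp (- (z * of_real t)) * J (y * t))
      = (\<integral>\<tau>. F t \<tau> \<partial>lborel) / (2 * pi)" for t
  proof (cases "t > 0")
    case True
    have "J (y * t) = (\<integral>\<tau>. K (Complex \<sigma> \<tau>) * of_real (y * t) powr (Complex \<sigma> \<tau> - 1) \<partial>lborel) / (2 * pi)"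
      using rep c y True by (simp add: inverse_mellin_rep_def)
    moreover have "F t \<tau> = of_real t powr (- lam) * exp (- (z * of_real t)) *
        (K (Complex \<sigma> \<tau>) * of_real (y * t) powr (Complex \<sigma> \<tau> - 1))" for \<tau>
    proof -
      have "complex_of_real (y * t) powr (Complex \<sigma> \<tau> - 1) =
          of_real y powr (Complex \<sigma> \<tau> - 1) * of_real t powr (Complex \<sigma> \<tau> - 1)"
        using True y by (simp add: powr_times_real)
      moreover have "exp ((Complex \<sigma> \<tau> - lam - 1) * of_real (ln t)) =
           of_real t powr (Complex \<sigma> \<tau> - 1) * of_real t powr (- lam)"
        using True by (simp add: powr_eq_exp_ln exp_add[symmetric] algebra_simps)
      ultimately show ?thesis
        using True by (simp add: F_def k_def)
    qed
    ultimately show ?thesis using True by simp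
  qed (simp add: F_def)
  then have "(LINT t:{0<..}|lborel. of_real t powr (- lam) * exp (- (z * of_real t)) * J (y * t)) =
      (\<integral>t. (\<integral>\<tau>. F t \<tau> \<partial>lborel) \<partial>lborel) / (2 * pi)"
    by (simp add: set_lebesgue_integral_def)
  moreover have "(\<integral>t. (\<integral>\<tau>. F t \<tau> \<partial>lborel) \<partial>lborel) = (\<integral>\<tau>. (\<integral>t. F t \<tau> \<partial>lborel) \<partial>lborel)"
    using lborel_pair.Fubini_integral[OF int] by simp
  moreover have inner: "(\<integral>t. F t \<tau> \<partial>lborel) = k \<tau> * (Gamma (Complex \<sigma> \<tau> - lam) * z powr (- (Complex \<sigma> \<tau> - lam)))" for \<tau>
  proof -
    have "F t \<tau> = k \<tau> * (indicator {0<..} t *\<^sub>R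
        (of_real t powr (Complex \<sigma> \<tau> - lam - 1) * exp (- (z * of_real t))))" for t
      by (auto simp: F_def indicator_def powr_eq_exp_ln)
    then have "(\<integral>t. F t \<tau> \<partial>lborel) = k \<tau> *
        (LINT t:{0<..}|lborel. of_real t powr (Complex \<sigma> \<tau> - lam - 1) * exp (- (z * of_real t)))"
      unfolding set_lebesgue_integral_def by (simp only: integral_mult_right_zero)
    then show ?thesis
      using \<sigma> z by (simp add: laplace_power)
  qed
  ultimately show ?thesis by (simp add: inner k_def)
qed

text \<open>\<open>g\<close> is a polynomial majorant of the new Gamma factor together with its
  largest exponential weight. Integrability against \<open>K\<close> serves dominated convergence;
  the last clause hands rapid decay on to the next kernel.\<close>

lemma oscillatory_kernel_decay:
  assumes \<sigma>: "\<sigma> > Re lam"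
  obtains g where "integrable lborel (\<lambda>t. norm (K (Complex \<sigma> t)) * g t)"
    "\<And>t. norm (Gamma (Complex \<sigma> t - lam)) * exp (pi / 2 * \<bar>t - Im lam\<bar>) \<le> g t"
    "\<And>N. \<exists>C. \<forall>t. norm (K (Complex \<sigma> t)) * g t * (1 + t\<^sup>2) ^ N \<le> C"
proof -
  have c: "\<sigma> > c" using \<sigma> lam by simp
  obtain C M where C: "C \<ge> 0" and
    G: "\<And>b. norm (Gamma (Complex (\<sigma> - Re lam) b)) * exp (pi / 2 * \<bar>b\<bar>) \<le> C * (1 + b\<^sup>2) ^ M"
    using \<sigma> Gamma_vertical_bound[of "\<sigma> - Re lam"] by auto
  define g where "g = (\<lambda>t. C * (2 * (1 + (Im lam)\<^sup>2) * (1 + t\<^sup>2)) ^ M)"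
  have [measurable]: "(\<lambda>t. K (Complex \<sigma> t)) \<in> borel_measurable borel"
    using rep c by (simp add: inverse_mellin_rep_def)
  have decay: "\<exists>C'. \<forall>t. norm (K (Complex \<sigma> t)) * g t * (1 + t\<^sup>2) ^ N \<le> C'" for N
  proof -
    \<comment> \<open>Of the \<open>M + N\<close> available powers, \<open>M\<close> pay for the
      growth of \<open>g\<close>.\<close>
    obtain B where B: "\<And>t. norm (K (Complex \<sigma> t)) * (1 + t\<^sup>2) ^ (M + N) \<le> B"
      using rep c unfolding inverse_mellin_rep_def by blast
    have "norm (K (Complex \<sigma> t)) * g t * (1 + t\<^sup>2) ^ N =
       (C * (2 * (1 + (Im lam)\<^sup>2)) ^ M) * (norm (K (Complex \<sigma> t)) * (1 + t\<^sup>2) ^ (M + N))" for t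
      by (simp add: g_def power_mult_distrib power_add)
    also have "\<dots> t \<le> (C * (2 * (1 + (Im lam)\<^sup>2)) ^ M) * B" for t
      using B C by (intro mult_left_mono) auto
    finally show ?thesis by blast
  qed
  show ?thesis
  proof (rule that)
    show "integrable lborel (\<lambda>t. norm (K (Complex \<sigma> t)) * g t)"
    proof -
      obtain B where B: "\<And>t. norm (K (Complex \<sigma> t)) * g t * (1 + t\<^sup>2) ^ 1 \<le> B"
        using decay by blast
      have "integrable lborel (\<lambda>t. complex_of_real (norm (K (Complex \<sigma> t)) * g t))"
        using B C by (intro integrable_lborel_if_quadratic_decay[where C = B])
                   (simp_all only: norm_of_real, simp_all add: g_def)
      then show ?thesis by (simp only: complex_of_real_integrable_eq)
    qed
    fix t
    have "Complex \<sigma> t - lam = Complex (\<sigma> - Re lam) (t - Im lam)" by (simp add: complex_eq_iff)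
    then have "norm (Gamma (Complex \<sigma> t - lam)) * exp (pi / 2 * \<bar>t - Im lam\<bar>) \<le> C * (1 + (t - Im lam)\<^sup>2) ^ M"
      using G[of "t - Im lam"] by simp
    also have "\<dots> \<le> g t"
      unfolding g_def using C one_plus_diff_square_le[of t "Im lam"]
      by (intro mult_left_mono power_mono) auto
    finally show "norm (Gamma (Complex \<sigma> t - lam)) * exp (pi / 2 * \<bar>t - Im lam\<bar>) \<le> g t" .
  qed (rule decay)
qed

lemma oscillatory_integral:
  assumes y: "y > 0" and \<sigma>: "\<sigma> > Re lam"
  shows "(LINT t:{0<..}|lborel. of_real t powr (- lam) * exp (of_real sg * \<i> * of_real t) * J (y * t)) =
     (\<integral>t. K (Complex \<sigma> t) * of_real y powr (Complex \<sigma> t - 1) *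
           (Gamma (Complex \<sigma> t - lam) * ee (of_real sg * (Complex \<sigma> t - lam) / 4)) \<partial>lborel) / (2 * pi)"
proof -
  have c: "\<sigma> > c" using \<sigma> lam by simp
  have [measurable]: "(\<lambda>t. K (Complex \<sigma> t)) \<in> borel_measurable borel"
    using rep c by (simp add: inverse_mellin_rep_def)
  have [measurable]: "(\<lambda>t. complex_of_real y powr (Complex \<sigma> t - 1)) \<in> borel_measurable borel"
    using y by (simp add: powr_eq_exp_ln)
  have [measurable]: "(\<lambda>t. Gamma (Complex \<sigma> t - lam)) \<in> borel_measurable borel"
    using \<sigma> by (rule borel_measurable_Gamma_vertical)
  have cts: "(\<lambda>t. (z powr (- (Complex \<sigma> t - lam)))) \<in> borel_measurable borel" if "z \<noteq> 0" for z
    using that by (simp add: powr_def)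
  \<comment> \<open>Both sides are limits of the damped identity as \<open>z\<close> tends to \<open>- sg \<i>\<close> from the right;
    \<open>|z n| \<ge> 1\<close> and \<open>|Arg (z n)| \<le> pi / 2\<close> make the bound on the right-hand side uniform.\<close>
  define z where "z = (\<lambda>n. complex_of_real (inverse (real (Suc n))) - of_real sg * \<i>)"
  have z: "Re (z n) > 0" "norm (z n) \<ge> 1" "z n \<noteq> 0" for n
  proof -
    show Re: "Re (z n) > 0" by (simp add: z_def)
    then show "z n \<noteq> 0" by auto
    show "norm (z n) \<ge> 1" using abs_Im_le_cmod[of "z n"] sg by (auto simp: z_def)
  qed
  have "(\<lambda>n. complex_of_real (inverse (real (Suc n)))) \<longlonglongrightarrow> of_real 0"
    by (intro tendsto_of_real LIMSEQ_inverse_real_of_nat)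
  then have z_lim: "z \<longlonglongrightarrow> - (of_real sg * \<i>)"
    using tendsto_diff[OF _ tendsto_const, of _ "of_real 0" sequentially "of_real sg * \<i>"]
    by (simp add: z_def)
  \<comment> \<open>The integrand without its exponential is already absolutely integrable and
    dominates the left-hand sides, since \<open>exp (- (z n * t))\<close> has modulus at most 1 for
    \<open>t > 0\<close>.\<close>
  define h where "h = (\<lambda>t. indicator {0<..} t *\<^sub>R (of_real t powr (- lam) * J (y * t)))"
  have int_h: "integrable lborel h"
    using inverse_mellin_rep_set_integrable[OF rep lam y] by (simp add: set_integrable_def h_def)
  then have [measurable]: "h \<in> borel_measurable lborel" by auto
  have L1: "(\<lambda>n. \<integral>t. exp (- (z n * of_real t)) * h t \<partial>lborel) \<longlonglongrightarrow> (\<integral>t. exp (of_real sg * \<i> * of_real t) * h t \<partial>lborel)"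
  proof (rule integral_dominated_convergence[where w = "\<lambda>t. norm (h t)"])
    show "AE t in lborel. (\<lambda>n. exp (- (z n * of_real t)) * h t) \<longlonglongrightarrow> exp (of_real sg * \<i> * of_real t) * h t"
      using z_lim by (intro AE_I2) (auto intro!: tendsto_eq_intros)
    show "AE t in lborel. norm (exp (- (z n * of_real t)) * h t) \<le> norm (h t)" for n
      using z(1)[of n] by (intro AE_I2) (auto simp: norm_mult h_def indicator_def intro!: mult_left_le_one_le)
  qed (use int_h in auto)
  obtain g where g: "integrable lborel (\<lambda>t. norm (K (Complex \<sigma> t)) * g t)"
    "\<And>t. norm (Gamma (Complex \<sigma> t - lam)) * exp (pi / 2 * \<bar>t - Im lam\<bar>) \<le> g t"
    using oscillatory_kernel_decay[OF \<sigma>] by metis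
  let ?k = "\<lambda>t. K (Complex \<sigma> t) * of_real y powr (Complex \<sigma> t - 1)"
  have L2: "(\<lambda>n. \<integral>t. ?k t * (Gamma (Complex \<sigma> t - lam) * z n powr (- (Complex \<sigma> t - lam))) \<partial>lborel)
     \<longlonglongrightarrow> (\<integral>t. ?k t * (Gamma (Complex \<sigma> t - lam) * (- (of_real sg * \<i>)) powr (- (Complex \<sigma> t - lam))) \<partial>lborel)"
  proof (rule integral_dominated_convergence[where w = "\<lambda>t. y powr (\<sigma> - 1) * (norm (K (Complex \<sigma> t)) * g t)"])
    show "(\<lambda>t. ?k t * (Gamma (Complex \<sigma> t - lam) * (- (of_real sg * \<i>)) powr (- (Complex \<sigma> t - lam)))) \<in> borel_measurable lborel"
      using cts[of "- (of_real sg * \<i>)"] sg by auto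
    show "(\<lambda>t. ?k t * (Gamma (Complex \<sigma> t - lam) * z n powr (- (Complex \<sigma> t - lam)))) \<in> borel_measurable lborel" for n
      using cts[of "z n"] z by auto
    show "integrable lborel (\<lambda>t. y powr (\<sigma> - 1) * (norm (K (Complex \<sigma> t)) * g t))"
      using g(1) by (rule integrable_mult_right)
    \<comment> \<open>The limit point lies off the branch cut, so the complex power is continuous
      there.\<close>
    have "- (of_real sg * \<i>) \<notin> \<real>\<^sub>\<le>\<^sub>0" using sg by (auto simp: complex_nonpos_Reals_iff)
    then show "AE t in lborel. (\<lambda>n. ?k t * (Gamma (Complex \<sigma> t - lam) * z n powr (- (Complex \<sigma> t - lam))))
      \<longlonglongrightarrow> ?k t * (Gamma (Complex \<sigma> t - lam) * (- (of_real sg * \<i>)) powr (- (Complex \<sigma> t - lam)))"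
      using z_lim by (intro AE_I2 tendsto_intros) auto
    show "AE t in lborel. norm (?k t * (Gamma (Complex \<sigma> t - lam) * z n powr (- (Complex \<sigma> t - lam))))
       \<le> y powr (\<sigma> - 1) * (norm (K (Complex \<sigma> t)) * g t)" for n
    proof (rule AE_I2)
      fix t
      have "\<bar>Im (Ln (z n))\<bar> \<le> pi / 2"
        using Re_Ln_pos_le[of "z n"] z[of n] by linarith
      then have "\<bar>t - Im lam\<bar> * \<bar>Im (Ln (z n))\<bar> \<le> \<bar>t - Im lam\<bar> * (pi / 2)"
        by (intro mult_left_mono) auto
      moreover have "(t - Im lam) * Im (Ln (z n)) \<le> \<bar>t - Im lam\<bar> * \<bar>Im (Ln (z n))\<bar>"
        using abs_ge_self[of "(t - Im lam) * Im (Ln (z n))"] by (simp add: abs_mult)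
      ultimately have "exp ((t - Im lam) * Im (Ln (z n))) \<le> exp (pi / 2 * \<bar>t - Im lam\<bar>)"
        by (simp add: mult.commute)
      moreover have "norm (z n) powr (- (\<sigma> - Re lam)) \<le> 1"
        using z[of n] \<sigma> powr_mono2'[of "- (\<sigma> - Re lam)" 1 "norm (z n)"] by simp
      moreover have "norm (z n powr (- (Complex \<sigma> t - lam))) = norm (z n) powr (- (\<sigma> - Re lam)) * exp ((t - Im lam) * Im (Ln (z n)))"
        using z[of n] by (simp add: norm_powr_complex algebra_simps)
      ultimately have "norm (z n powr (- (Complex \<sigma> t - lam))) \<le> 1 * exp (pi / 2 * \<bar>t - Im lam\<bar>)"
        by (simp only:) (intro mult_mono, auto)
      then have "norm (Gamma (Complex \<sigma> t - lam)) * norm (z n powr (- (Complex \<sigma> t - lam)))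
          \<le> norm (Gamma (Complex \<sigma> t - lam)) * exp (pi / 2 * \<bar>t - Im lam\<bar>)"
        by (intro mult_left_mono) auto
      also have "\<dots> \<le> g t" by (rule g)
      finally show "norm (?k t * (Gamma (Complex \<sigma> t - lam) * z n powr (- (Complex \<sigma> t - lam))))
          \<le> y powr (\<sigma> - 1) * (norm (K (Complex \<sigma> t)) * g t)"
        using y by (simp add: norm_mult norm_powr_real_powr mult_left_mono mult.left_commute mult.assoc)
    qed
  qed
  have "(\<integral>t. exp (- (z n * of_real t)) * h t \<partial>lborel) =
      (\<integral>t. ?k t * (Gamma (Complex \<sigma> t - lam) * z n powr (- (Complex \<sigma> t - lam))) \<partial>lborel) / (2 * pi)" for n
    using damped_oscillatory_integral[OF y \<sigma> z(1)[of n]]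
    by (simp add: set_lebesgue_integral_def h_def mult_ac)
  with L1 have "(\<lambda>n. (\<integral>t. ?k t * (Gamma (Complex \<sigma> t - lam) * z n powr (- (Complex \<sigma> t - lam))) \<partial>lborel) / (2 * pi))
      \<longlonglongrightarrow> (\<integral>t. exp (of_real sg * \<i> * of_real t) * h t \<partial>lborel)" by simp
  moreover have "(\<lambda>n. (\<integral>t. ?k t * (Gamma (Complex \<sigma> t - lam) * z n powr (- (Complex \<sigma> t - lam))) \<partial>lborel) / (2 * pi))
      \<longlonglongrightarrow> (\<integral>t. ?k t * (Gamma (Complex \<sigma> t - lam) * (- (of_real sg * \<i>)) powr (- (Complex \<sigma> t - lam))) \<partial>lborel) / (2 * pi)"
    using L2 by (intro tendsto_intros) auto
  ultimately have "(\<integral>t. exp (of_real sg * \<i> * of_real t) * h t \<partial>lborel) =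
      (\<integral>t. ?k t * (Gamma (Complex \<sigma> t - lam) * (- (of_real sg * \<i>)) powr (- (Complex \<sigma> t - lam))) \<partial>lborel) / (2 * pi)"
    by (rule LIMSEQ_unique)
  then show ?thesis
    unfolding powr_minus_imaginary_unit[OF sg] by (simp add: set_lebesgue_integral_def h_def mult_ac)
qed

text \<open>The induction step of the whole argument: one more integration multiplies the kernel by
  one Gamma factor. The threshold rises from \<open>c\<close> to \<open>Re lam\<close>, because the
  Laplace integral for \<open>Gamma (s - lam)\<close> requires \<open>Re s > Re lam\<close>.\<close>

lemma inverse_mellin_rep_oscillatory:
  "inverse_mellin_rep (Re lam) (\<lambda>s. Gamma (s - lam) * ee (of_real sg * (s - lam) / 4) * K s)
     (\<lambda>y. LINT t:{0<..}|lborel. of_real t powr (- lam) * exp (of_real sg * \<i> * of_real t) * J (y * t))"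
  unfolding inverse_mellin_rep_def
proof (intro allI impI conjI)
  fix \<sigma> assume \<sigma>: "\<sigma> > Re lam"
  then have c: "\<sigma> > c" using lam by simp
  have [measurable]: "(\<lambda>t. K (Complex \<sigma> t)) \<in> borel_measurable borel"
    using rep c by (simp add: inverse_mellin_rep_def)
  have [measurable]: "(\<lambda>t. Gamma (Complex \<sigma> t - lam)) \<in> borel_measurable borel"
    using \<sigma> by (rule borel_measurable_Gamma_vertical)
  show "(\<lambda>t. Gamma (Complex \<sigma> t - lam) * ee (of_real sg * (Complex \<sigma> t - lam) / 4) * K (Complex \<sigma> t)) \<in> borel_measurable borel"
    unfolding ee_def by measurable
  show "(LINT t:{0<..}|lborel. of_real t powr (- lam) * exp (of_real sg * \<i> * of_real t) * J (y * t)) =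
    (\<integral>t. Gamma (Complex \<sigma> t - lam) * ee (of_real sg * (Complex \<sigma> t - lam) / 4) * K (Complex \<sigma> t) *
         of_real y powr (Complex \<sigma> t - 1) \<partial>lborel) / (2 * pi)" if "y > 0" for y
    using oscillatory_integral[OF that \<sigma>] by (simp add: mult_ac)
  fix N
  obtain g where "integrable lborel (\<lambda>t. norm (K (Complex \<sigma> t)) * g t)"
    and g: "\<And>t. norm (Gamma (Complex \<sigma> t - lam)) * exp (pi / 2 * \<bar>t - Im lam\<bar>) \<le> g t"
    and decay: "\<And>N. \<exists>C. \<forall>t. norm (K (Complex \<sigma> t)) * g t * (1 + t\<^sup>2) ^ N \<le> C"
    using oscillatory_kernel_decay[OF \<sigma>] by blast
  from decay obtain C where C: "\<And>t. norm (K (Complex \<sigma> t)) * g t * (1 + t\<^sup>2) ^ N \<le> C" by blast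
  have "norm (Gamma (Complex \<sigma> t - lam) * ee (of_real sg * (Complex \<sigma> t - lam) / 4) * K (Complex \<sigma> t)) * (1 + t\<^sup>2) ^ N \<le> C" for t
  proof -
    \<comment> \<open>In one of the two directions \<open>ee\<close> grows like
      \<open>exp (pi / 2 * |t - Im lam|)\<close>; this is exactly the weight included in
      \<open>g\<close>.\<close>
    have "- (sg * (t - Im lam)) \<le> \<bar>t - Im lam\<bar>" using sg by auto
    then have "exp (- (pi / 2 * (sg * (t - Im lam)))) \<le> exp (pi / 2 * \<bar>t - Im lam\<bar>)"
      using mult_left_mono[of "- (sg * (t - Im lam))" "\<bar>t - Im lam\<bar>" "pi / 2"]
      by (simp only: mult_minus_right exp_le_cancel_iff) simp
    then have "norm (Gamma (Complex \<sigma> t - lam) * ee (of_real sg * (Complex \<sigma> t - lam) / 4))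
        \<le> norm (Gamma (Complex \<sigma> t - lam)) * exp (pi / 2 * \<bar>t - Im lam\<bar>)"
      unfolding norm_mult norm_ee by (intro mult_left_mono) auto
    also have "\<dots> \<le> g t" by (rule g)
    finally have "norm (K (Complex \<sigma> t)) * norm (Gamma (Complex \<sigma> t - lam) * ee (of_real sg * (Complex \<sigma> t - lam) / 4)) * (1 + t\<^sup>2) ^ N
        \<le> norm (K (Complex \<sigma> t)) * g t * (1 + t\<^sup>2) ^ N"
      by (intro mult_right_mono mult_left_mono) auto
    also have "\<dots> \<le> C" by (rule C)
    finally show ?thesis by (simp add: norm_mult mult_ac)
  qed
  then show "\<exists>C. \<forall>t. norm (Gamma (Complex \<sigma> t - lam) * ee (of_real sg * (Complex \<sigma> t - lam) / 4) * K (Complex \<sigma> t)) * (1 + t\<^sup>2) ^ N \<le> C"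
    by blast
qed

end

subsection \<open>Fourier inversion\<close>

lemma integrable_gaussian:
  assumes "e > 0"
  shows "integrable lborel (\<lambda>t::real. exp (- (e * t)\<^sup>2 / 2))"
proof -
  have "integrable lborel (\<lambda>t. sqrt (2 * pi) * std_normal_density (0 + e * t))"
    using assms by (intro integrable_mult_right lborel_integrable_real_affine) auto
  then show ?thesis by (simp add: std_normal_density_def)
qed

text \<open>A rescaled form of the characteristic function of the standard normal
  distribution.\<close>

lemma integral_gaussian_fourier:
  assumes "e > 0"
  shows "(\<integral>t. exp (\<i> * of_real (a * t)) * of_real (exp (- (e * t)\<^sup>2 / 2)) \<partial>lborel)
           = complex_of_real (sqrt (2 * pi) / e * exp (- (a / e)\<^sup>2 / 2))"
proof -
  let ?f = "\<lambda>t. exp (\<i> * of_real (a * t)) * complex_of_real (exp (- (e * t)\<^sup>2 / 2))"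
  have "complex_of_real (exp (- (a / e)\<^sup>2 / 2)) = char std_normal_distribution (a / e)"
    by (simp add: char_std_normal_distribution)
  also have "\<dots> = (\<integral>x. std_normal_density x *\<^sub>R iexp (a / e * x) \<partial>lborel)"
    unfolding char_def by (subst integral_density) auto
  also have "\<dots> = (\<integral>x. of_real (1 / sqrt (2 * pi)) * ?f (0 + 1 / e * x) \<partial>lborel)"
    using assms by (intro Bochner_Integration.integral_cong)
       (auto simp: std_normal_density_def scaleR_conv_of_real)
  also have "\<dots> = of_real (1 / sqrt (2 * pi)) * (\<integral>x. ?f (0 + 1 / e * x) \<partial>lborel)"
    by (simp only: integral_mult_right_zero)
  also have "(\<integral>x. ?f (0 + 1 / e * x) \<partial>lborel) = of_real e * integral\<^sup>L lborel ?f"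
    using assms lborel_integral_real_affine[of "1 / e" ?f 0] by (simp add: scaleR_conv_of_real)
  finally have "of_real (sqrt (2 * pi) / e) * complex_of_real (exp (- (a / e)\<^sup>2 / 2)) = integral\<^sup>L lborel ?f"
    using assms by (simp add: field_simps)
  then show ?thesis by (simp only: of_real_mult)
qed

lemma integral_gaussian:
  "(\<integral>t. complex_of_real (exp (- t\<^sup>2 / 2)) \<partial>lborel) = of_real (sqrt (2 * pi))"
  using integral_gaussian_fourier[of 1 0] by simp

text \<open>Gaussian summation: the inverse integral is damped by
  \<open>exp (- (e * t)\<^sup>2 / 2)\<close>, and Fubini turns it into an average of
  \<open>g\<close> around \<open>v\<close> at scale \<open>e\<close>. As \<open>e\<close> tends to
  0, integrability of \<open>\<phi>\<close> gives the limit of the first form, continuity and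
  boundedness of \<open>g\<close> that of the second.\<close>

lemma fourier_inversion:
  fixes g :: "real \<Rightarrow> complex"
  defines "\<phi> \<equiv> \<lambda>t. \<integral>u. g u * exp (- (\<i> * of_real (t * u))) \<partial>lborel"
  assumes g: "integrable lborel g" "continuous_on UNIV g" and B: "\<And>u. norm (g u) \<le> B"
    and \<phi>: "integrable lborel \<phi>"
  shows "(\<integral>t. \<phi> t * exp (\<i> * of_real (t * v)) \<partial>lborel) = 2 * pi * g v"
proof -
  have [measurable]: "g \<in> borel_measurable borel" "\<phi> \<in> borel_measurable borel"
    using g \<phi> by auto
  define e where "e = (\<lambda>n. inverse (real (Suc n)))"
  have e: "e n > 0" for n by (simp add: e_def)
  have e_lim: "e \<longlonglongrightarrow> 0" unfolding e_def by (rule LIMSEQ_inverse_real_of_nat)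
  let ?E = "\<lambda>x::real. exp (- x\<^sup>2 / 2)"
  let ?A = "\<lambda>n. \<integral>t. \<phi> t * exp (\<i> * of_real (t * v)) * of_real (?E (e n * t)) \<partial>lborel"
  have "?A \<longlonglongrightarrow> (\<integral>t. \<phi> t * exp (\<i> * of_real (t * v)) * of_real (?E (0 * t)) \<partial>lborel)"
  proof (rule integral_dominated_convergence[where w = "\<lambda>t. norm (\<phi> t)"])
    show "AE t in lborel. (\<lambda>n. \<phi> t * exp (\<i> * of_real (t * v)) * of_real (?E (e n * t)))
        \<longlonglongrightarrow> \<phi> t * exp (\<i> * of_real (t * v)) * of_real (?E (0 * t))"
      by (intro AE_I2 tendsto_intros e_lim) auto
    show "AE t in lborel. norm (\<phi> t * exp (\<i> * of_real (t * v)) * of_real (?E (e n * t))) \<le> norm (\<phi> t)" for n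
      by (intro AE_I2) (auto simp: norm_mult intro!: mult_left_le)
    show "integrable lborel (\<lambda>t. norm (\<phi> t))" using \<phi> by simp
  qed measurable
  then have lim1: "?A \<longlonglongrightarrow> (\<integral>t. \<phi> t * exp (\<i> * of_real (t * v)) \<partial>lborel)" by simp
  have A_eq: "?A n = of_real (sqrt (2 * pi)) * (\<integral>w. g (v + e n * w) * of_real (?E w) \<partial>lborel)" for n
  proof -
    define F where "F = (\<lambda>u t. g u * (exp (\<i> * of_real ((v - u) * t)) * of_real (?E (e n * t))))"
    have int: "integrable (lborel \<Otimes>\<^sub>M lborel) (case_prod F)"
    proof (rule integrable_lborel_pair_if_product_bound)
      show "case_prod F \<in> borel_measurable (lborel \<Otimes>\<^sub>M lborel)"
        unfolding F_def by measurable
      show "integrable lborel (\<lambda>u. norm (g u))" using g by simp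
      show "integrable lborel (\<lambda>t. ?E (e n * t))" by (rule integrable_gaussian[OF e])
      show "norm (case (u, t) of (u, t) \<Rightarrow> F u t) \<le> norm (g u) * ?E (e n * t)" for u t
        by (simp add: F_def norm_mult)
    qed
    have "\<phi> t * exp (\<i> * of_real (t * v)) * of_real (?E (e n * t)) = (\<integral>u. F u t \<partial>lborel)" for t
    proof -
      have "F u t = g u * exp (- (\<i> * of_real (t * u))) * (exp (\<i> * of_real (t * v)) * of_real (?E (e n * t)))" for u
        by (simp add: F_def mult.assoc exp_add[symmetric] exp_of_real[symmetric] algebra_simps)
      then have "(\<integral>u. F u t \<partial>lborel) = \<phi> t * (exp (\<i> * of_real (t * v)) * of_real (?E (e n * t)))"
        unfolding \<phi>_def by (simp only: integral_mult_left_zero)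
      then show ?thesis by (simp only: mult.assoc)
    qed
    then have "?A n = (\<integral>t. (\<integral>u. F u t \<partial>lborel) \<partial>lborel)" by simp
    also have "\<dots> = (\<integral>u. (\<integral>t. F u t \<partial>lborel) \<partial>lborel)"
      using lborel_pair.Fubini_integral[OF int] by simp
    also have "\<dots> = (\<integral>u. g u * complex_of_real (sqrt (2 * pi) / e n * ?E ((v - u) / e n)) \<partial>lborel)"
      unfolding F_def by (simp only: integral_mult_right_zero integral_gaussian_fourier[OF e])
    also have "\<dots> = of_real (e n) * (\<integral>w. g (v + e n * w) * complex_of_real (sqrt (2 * pi) / e n * ?E w) \<partial>lborel)"
      using e[of n] by (subst lborel_integral_real_affine[of "e n" _ v]) (auto simp: scaleR_conv_of_real)
    also have "\<dots> = of_real (sqrt (2 * pi)) * (\<integral>w. g (v + e n * w) * of_real (?E w) \<partial>lborel)"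
      unfolding integral_mult_right_zero[symmetric] using e[of n]
      by (intro Bochner_Integration.integral_cong) (auto simp: field_simps)
    finally show ?thesis .
  qed
  have "(\<lambda>n. \<integral>w. g (v + e n * w) * of_real (?E w) \<partial>lborel) \<longlonglongrightarrow> (\<integral>w. g (v + 0 * w) * of_real (?E w) \<partial>lborel)"
  proof (rule integral_dominated_convergence[where w = "\<lambda>w. B * ?E w"])
    have "(\<lambda>n. g (v + e n * w)) \<longlonglongrightarrow> g (v + 0 * w)" for w
      using g(2) by (intro isCont_tendsto_compose[of _ g] tendsto_intros e_lim)
                    (simp add: continuous_on_eq_continuous_at)
    then show "AE w in lborel. (\<lambda>n. g (v + e n * w) * of_real (?E w)) \<longlonglongrightarrow> g (v + 0 * w) * of_real (?E w)"
      by (intro AE_I2 tendsto_intros)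
    show "AE w in lborel. norm (g (v + e n * w) * of_real (?E w)) \<le> B * ?E w" for n
      using B by (intro AE_I2) (auto simp: norm_mult intro!: mult_right_mono)
    show "integrable lborel (\<lambda>w. B * ?E w)" using integrable_gaussian[of 1] by simp
  qed measurable
  then have "(\<lambda>n. \<integral>w. g (v + e n * w) * of_real (?E w) \<partial>lborel) \<longlonglongrightarrow> g v * of_real (sqrt (2 * pi))"
    by (simp only: mult_zero_left add_0_right integral_mult_right_zero integral_gaussian)
  then have "?A \<longlonglongrightarrow> of_real (sqrt (2 * pi)) * (g v * of_real (sqrt (2 * pi)))"
    unfolding A_eq by (intro tendsto_intros)
  from LIMSEQ_unique[OF lim1 this]
  have "(\<integral>t. \<phi> t * exp (\<i> * of_real (t * v)) \<partial>lborel) =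
      (complex_of_real (sqrt (2 * pi)) * of_real (sqrt (2 * pi))) * g v"
    by (simp only: mult_ac)
  also have "complex_of_real (sqrt (2 * pi)) * of_real (sqrt (2 * pi)) = of_real (2 * pi)"
    by (subst of_real_mult[symmetric]) simp
  finally show ?thesis .
qed

subsection \<open>Mellin inversion for rapidly decaying functions\<close>

lemma nth_vderiv_0 [simp]: "nth_vderiv 0 f = f"
  by (simp add: nth_vderiv_def)

lemma nth_vderiv_vector_derivative:
  "nth_vderiv k (\<lambda>x. vector_derivative f (at x)) = nth_vderiv (Suc k) f"
  by (simp add: nth_vderiv_def funpow_Suc_right del: funpow.simps)

context
  fixes f :: "real \<Rightarrow> complex"
  assumes f: "f \<in> schwartz_pos"
begin

lemma schwartz_pos_vector_derivative:
  "(\<lambda>x. vector_derivative f (at x)) \<in> schwartz_pos"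
  using f by (simp add: schwartz_pos_def nth_vderiv_vector_derivative)

lemma schwartz_pos_has_vector_derivative:
  assumes "x > 0"
  shows "(f has_vector_derivative vector_derivative f (at x)) (at x)"
proof -
  have "nth_vderiv 0 f differentiable at x" using f assms unfolding schwartz_pos_def by blast
  then show ?thesis by (simp add: vector_derivative_works[symmetric])
qed

lemma schwartz_pos_isCont: "x > 0 \<Longrightarrow> isCont f x"
  using schwartz_pos_has_vector_derivative has_vector_derivative_continuous by blast

text \<open>Passes from integer to real exponents: \<open>x powr a\<close> is at most its neighbour
  with the upper integer exponent for \<open>x \<ge> 1\<close> and the one with the lower exponent
  for \<open>x < 1\<close>, so the sum of the two integer bounds suffices.\<close>

lemma schwartz_pos_bound:
  obtains C where "\<And>x. x > 0 \<Longrightarrow> norm (f x) * x powr a \<le> C"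
proof -
  have "\<exists>C. \<forall>x>0. norm (f x) * x powi b \<le> C" for b :: int
  proof -
    have "bounded ((\<lambda>x. complex_of_real (x powi b) * nth_vderiv 0 f x) ` {0<..})"
      using f unfolding schwartz_pos_def by blast
    then obtain C where "\<And>x. x > 0 \<Longrightarrow> norm (complex_of_real (x powi b) * f x) \<le> C"
      unfolding bounded_iff by auto
    moreover have "norm (complex_of_real (x powi b) * f x) = norm (f x) * x powi b" if "x > 0" for x
      using that by (simp add: norm_mult norm_power_int)
    ultimately show ?thesis by (intro exI[of _ C]) auto
  qed
  then obtain C where C: "\<And>b x. x > 0 \<Longrightarrow> norm (f x) * x powi b \<le> C b" by metis
  have "norm (f x) * x powr a \<le> C \<lfloor>a\<rfloor> + C (\<lfloor>a\<rfloor> + 1)" if x: "x > 0" for x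
  proof -
    have "x powr a \<le> x powr of_int \<lfloor>a\<rfloor> + x powr of_int (\<lfloor>a\<rfloor> + 1)"
    proof (cases "x \<ge> 1")
      case True
      then have "x powr a \<le> x powr of_int (\<lfloor>a\<rfloor> + 1)" by (intro powr_mono) linarith+
      then show ?thesis by (simp add: add_increasing)
    next
      case False
      then have "x powr a \<le> x powr of_int \<lfloor>a\<rfloor>" using x by (intro powr_mono') auto
      then show ?thesis by (simp add: add_increasing2)
    qed
    also have "\<dots> = x powi \<lfloor>a\<rfloor> + x powi (\<lfloor>a\<rfloor> + 1)"
      using powr_real_of_int'[of x "\<lfloor>a\<rfloor>"] powr_real_of_int'[of x "\<lfloor>a\<rfloor> + 1"] x by simp
    finally have "norm (f x) * x powr a \<le> norm (f x) * (x powi \<lfloor>a\<rfloor> + x powi (\<lfloor>a\<rfloor> + 1))"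
      by (intro mult_left_mono) auto
    also have "\<dots> \<le> C \<lfloor>a\<rfloor> + C (\<lfloor>a\<rfloor> + 1)"
      unfolding distrib_left by (intro add_mono C x)
    finally show ?thesis .
  qed
  then show ?thesis by (rule that)
qed

lemma schwartz_pos_times_powr_isCont: "x > 0 \<Longrightarrow> isCont (\<lambda>x. f x * of_real x powr w) x"
  by (intro continuous_intros schwartz_pos_isCont) (auto simp: complex_nonpos_Reals_iff)

lemma schwartz_pos_set_integrable:
  "set_integrable lborel {0<..} (\<lambda>x. f x * of_real x powr w)"
proof -
  obtain A where A: "\<And>x. x > 0 \<Longrightarrow> norm (f x) * x powr Re w \<le> A" using schwartz_pos_bound by blast
  obtain B where B: "\<And>x. x > 0 \<Longrightarrow> norm (f x) * x powr (Re w + 2) \<le> B" using schwartz_pos_bound by blast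
  show ?thesis
  proof (rule set_integrable_pos_if_bounds)
    have "continuous_on {0<..} (\<lambda>x. f x * of_real x powr w)"
      by (intro continuous_at_imp_continuous_on ballI schwartz_pos_times_powr_isCont) auto
    then show "set_borel_measurable borel {0<..} (\<lambda>x. f x * of_real x powr w)"
      unfolding set_borel_measurable_def by (intro borel_measurable_continuous_on_indicator) auto
    show "(-2 :: real) < -1" by simp
    fix x :: real assume x: "x > 0"
    then show "norm (f x * of_real x powr w) \<le> A"
      using A[of x] by (simp add: norm_mult norm_powr_real_powr)
    show "norm (f x * of_real x powr w) \<le> B * x powr -2"
      using B[of x] x by (simp add: norm_mult norm_powr_real_powr powr_add powr_minus field_simps)
  qed
qed

end

text \<open>Integration by parts, written as the fundamental theorem for
  \<open>f x * x powr s\<close>, whose boundary values vanish at both ends.\<close>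

lemma mellin_vector_derivative:
  assumes f: "f \<in> schwartz_pos"
  shows "mellin (\<lambda>x. vector_derivative f (at x)) (s + 1) = - s * mellin f s"
proof -
  let ?f' = "\<lambda>x. vector_derivative f (at x)"
  let ?F = "\<lambda>x. f x * complex_of_real x powr s"
  let ?F' = "\<lambda>x. ?f' x * complex_of_real x powr s + s * (f x * of_real x powr (s - 1))"
  have int1: "set_integrable lborel {0<..} (\<lambda>x. ?f' x * of_real x powr s)"
    using schwartz_pos_set_integrable[OF schwartz_pos_vector_derivative[OF f]] by simp
  have int2: "set_integrable lborel {0<..} (\<lambda>x. s * (f x * of_real x powr (s - 1)))"
    using schwartz_pos_set_integrable[OF f] by simp
  \<comment> \<open>Exponents one below and one above \<open>Re s\<close> bound \<open>?F\<close> by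
    \<open>A * x\<close> near 0 and by \<open>B / x\<close> at infinity.\<close>
  obtain A where A: "\<And>x. x > 0 \<Longrightarrow> norm (f x) * x powr (Re s - 1) \<le> A" using schwartz_pos_bound[OF f] by blast
  obtain B where B: "\<And>x. x > 0 \<Longrightarrow> norm (f x) * x powr (Re s + 1) \<le> B" using schwartz_pos_bound[OF f] by blast
  have [simp]: "einterval 0 \<infinity> = {0<..}" by (auto simp: einterval_def)
  have "(LBINT x=0..\<infinity>. ?F' x) = 0 - 0"
  proof (rule interval_integral_FTC_integrable)
    show "(0::ereal) < \<infinity>" by simp
    show "(?F has_vector_derivative ?F' x) (at x)" if "0 < ereal x" for x
    proof -
      have "((\<lambda>x. complex_of_real x powr s) has_vector_derivative s * of_real x powr (s - 1)) (at x)"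
        using that by (intro has_vector_derivative_real_field) (auto intro!: derivative_eq_intros simp: complex_nonpos_Reals_iff)
      from has_vector_derivative_mult[OF schwartz_pos_has_vector_derivative[OF f] this] that
      show ?thesis by (simp add: algebra_simps)
    qed
    show "isCont ?F' x" if "0 < ereal x" for x
      using that f by (intro continuous_intros schwartz_pos_times_powr_isCont schwartz_pos_vector_derivative) auto
    show "set_integrable lborel (einterval 0 \<infinity>) ?F'"
      using set_integral_add(1)[OF int1 int2] by simp
    have "((\<lambda>x. A * x) \<longlongrightarrow> A * 0) (at_right 0)" by (intro tendsto_intros)
    then have "((\<lambda>x. A * x) \<longlongrightarrow> 0) (at_right 0)" by simp
    then have "(?F \<longlongrightarrow> 0) (at_right 0)"
    proof (rule Lim_null_comparison[rotated])
      have "norm (?F x) \<le> A * x" if "x > 0" for x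
        using A[of x] that by (simp add: norm_mult norm_powr_real_powr powr_diff field_simps)
      then show "\<forall>\<^sub>F x in at_right 0. norm (?F x) \<le> A * x"
        by (auto simp: eventually_at_filter)
    qed
    then show "((?F \<circ> real_of_ereal) \<longlongrightarrow> 0) (at_right 0)"
      unfolding zero_ereal_def by (simp only: ereal_tendsto_simps)
    have "((\<lambda>x. B * inverse x) \<longlongrightarrow> B * 0) at_top"
      by (intro tendsto_intros tendsto_inverse_0_at_top filterlim_ident)
    then have "((\<lambda>x. B * inverse x) \<longlongrightarrow> 0) at_top" by simp
    then have "(?F \<longlongrightarrow> 0) at_top"
    proof (rule Lim_null_comparison[rotated])
      have "norm (?F x) \<le> B * inverse x" if "x > 0" for x
        using B[of x] that by (simp add: norm_mult norm_powr_real_powr powr_add field_simps)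
      then show "\<forall>\<^sub>F x in at_top. norm (?F x) \<le> B * inverse x"
        using eventually_gt_at_top[of 0] by (rule eventually_mono[rotated])
    qed
    then show "((?F \<circ> real_of_ereal) \<longlongrightarrow> 0) (at_left \<infinity>)"
      by (simp only: ereal_tendsto_simps)
  qed
  then have "(LINT x:{0<..}|lborel. ?F' x) = 0"
    by (simp add: interval_lebesgue_integral_def)
  then show ?thesis
    using set_integral_add(2)[OF int1 int2] by (simp add: mellin_def add_eq_0_iff)
qed

text \<open>Each derivative gains a factor \<open>s\<close>, hence a power of \<open>|t|\<close>.
  Both \<open>f\<close> and \<open>\<sigma>\<close> vary in the induction because the derivative is
  evaluated on the line at \<open>\<sigma> + 1\<close>.\<close>

lemma mellin_vertical_power_decay:
  assumes "f \<in> schwartz_pos"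
  shows "\<exists>C. \<forall>t. norm (mellin f (Complex \<sigma> t)) * \<bar>t\<bar> ^ k \<le> C"
  using assms
proof (induction k arbitrary: f \<sigma>)
  case 0
  have "norm (mellin f (Complex \<sigma> t)) \<le> (LINT x:{0<..}|lborel. norm (f x) * x powr (\<sigma> - 1))" for t
  proof -
    have "norm (mellin f (Complex \<sigma> t)) \<le>
        (\<integral>x. norm (indicator {0<..} x *\<^sub>R (f x * complex_of_real x powr (Complex \<sigma> t - 1))) \<partial>lborel)"
      unfolding mellin_def set_lebesgue_integral_def by (rule integral_norm_bound)
    also have "\<dots> = (LINT x:{0<..}|lborel. norm (f x) * x powr (\<sigma> - 1))"
      unfolding set_lebesgue_integral_def
      by (intro Bochner_Integration.integral_cong) (auto simp: indicator_def norm_mult norm_powr_real_powr)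
    finally show ?thesis .
  qed
  then show ?case by auto
next
  case (Suc k)
  obtain C where C: "\<And>t. norm (mellin (\<lambda>x. vector_derivative f (at x)) (Complex (\<sigma> + 1) t)) * \<bar>t\<bar> ^ k \<le> C"
    using Suc.IH[OF schwartz_pos_vector_derivative[OF Suc.prems]] by blast
  have "norm (mellin f (Complex \<sigma> t)) * \<bar>t\<bar> ^ Suc k \<le> C" for t
  proof -
    have "\<bar>t\<bar> \<le> norm (Complex \<sigma> t)" using abs_Im_le_cmod[of "Complex \<sigma> t"] by simp
    then have "\<bar>t\<bar> * (norm (mellin f (Complex \<sigma> t)) * \<bar>t\<bar> ^ k)
        \<le> norm (Complex \<sigma> t) * (norm (mellin f (Complex \<sigma> t)) * \<bar>t\<bar> ^ k)"
      by (intro mult_right_mono) auto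
    then have "norm (mellin f (Complex \<sigma> t)) * \<bar>t\<bar> ^ Suc k
        \<le> norm (Complex \<sigma> t) * norm (mellin f (Complex \<sigma> t)) * \<bar>t\<bar> ^ k"
      by (simp only: power_Suc mult_ac)
    also have "\<dots> = norm (mellin (\<lambda>x. vector_derivative f (at x)) (Complex \<sigma> t + 1)) * \<bar>t\<bar> ^ k"
      by (simp add: mellin_vector_derivative[OF Suc.prems] norm_mult)
    also have "Complex \<sigma> t + 1 = Complex (\<sigma> + 1) t" by (simp add: complex_eq_iff)
    also have "norm (mellin (\<lambda>x. vector_derivative f (at x)) (Complex (\<sigma> + 1) t)) * \<bar>t\<bar> ^ k \<le> C" by (rule C)
    finally show ?thesis .
  qed
  then show ?case by blast
qed

lemma mellin_vertical_decay:
  assumes "f \<in> schwartz_pos"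
  shows "\<exists>C. \<forall>t. norm (mellin f (Complex \<sigma> t)) * (1 + t\<^sup>2) ^ N \<le> C"
proof -
  obtain A where A: "\<And>t. norm (mellin f (Complex \<sigma> t)) * \<bar>t\<bar> ^ 0 \<le> A"
    using mellin_vertical_power_decay[OF assms] by blast
  obtain B where B: "\<And>t. norm (mellin f (Complex \<sigma> t)) * \<bar>t\<bar> ^ (2 * N) \<le> B"
    using mellin_vertical_power_decay[OF assms] by blast
  have "norm (mellin f (Complex \<sigma> t)) * (1 + t\<^sup>2) ^ N \<le> 2 ^ N * (A + B)" for t
  proof -
    have "(1 + t\<^sup>2) ^ N \<le> (2 * max 1 (t\<^sup>2)) ^ N" by (intro power_mono) auto
    also have "\<dots> = 2 ^ N * max 1 (t\<^sup>2) ^ N" by (rule power_mult_distrib)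
    also have "max 1 (t\<^sup>2) ^ N \<le> 1 + \<bar>t\<bar> ^ (2 * N)"
      by (simp add: max_def power_mult)
    finally have "(1 + t\<^sup>2) ^ N \<le> 2 ^ N * (1 + \<bar>t\<bar> ^ (2 * N))" by simp
    then have "norm (mellin f (Complex \<sigma> t)) * (1 + t\<^sup>2) ^ N
        \<le> norm (mellin f (Complex \<sigma> t)) * (2 ^ N * (1 + \<bar>t\<bar> ^ (2 * N)))"
      by (intro mult_left_mono) auto
    also have "\<dots> = 2 ^ N * (norm (mellin f (Complex \<sigma> t)) * \<bar>t\<bar> ^ 0 + norm (mellin f (Complex \<sigma> t)) * \<bar>t\<bar> ^ (2 * N))"
      by (simp add: algebra_simps)
    also have "\<dots> \<le> 2 ^ N * (A + B)" by (intro mult_left_mono add_mono A B) auto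
    finally show ?thesis .
  qed
  then show ?thesis by blast
qed

lemma integrable_inverse_exp_sum:
  "integrable lborel (\<lambda>u::real. inverse (exp u + exp (- u)))"
proof (rule Bochner_Integration.integrable_bound)
  show "integrable lborel (\<lambda>u::real. 2 * inverse (1 + u\<^sup>2))"
    using integrable_inverse_1_plus_square by (simp add: set_integrable_def)
  have "norm (inverse (exp u + exp (- u))) \<le> norm (2 * inverse (1 + u\<^sup>2))" for u :: real
  proof -
    have "(1 + u\<^sup>2) / 2 \<le> exp \<bar>u\<bar>"
      using exp_lower_Taylor_quadratic[of "\<bar>u\<bar>"] by (simp add: field_simps)
    also have "\<dots> \<le> exp u + exp (- u)" by (cases "u \<ge> 0") auto
    finally have "inverse (exp u + exp (- u)) \<le> inverse ((1 + u\<^sup>2) / 2)"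
      by (intro le_imp_inverse_le) (auto simp: add_pos_nonneg)
    moreover have "0 < exp u + exp (- u)" by (intro add_pos_pos) auto
    ultimately show ?thesis by (simp add: abs_of_pos field_simps)
  qed
  then show "AE u in lborel. norm (inverse (exp u + exp (- u))) \<le> norm (2 * inverse (1 + u\<^sup>2) :: real)"
    by simp
qed measurable

section \<open>The Mellin transform as a Fourier transform in the logarithmic variable\<close>

context
  fixes f :: "real \<Rightarrow> complex" and \<sigma> :: real
  assumes f: "f \<in> schwartz_pos"
begin

lemma schwartz_pos_exp_continuous:
  "continuous_on UNIV (\<lambda>u. of_real (exp ((1 - \<sigma>) * u)) * f (exp u))"
  unfolding continuous_on_eq_continuous_at[OF open_UNIV]
  by (intro ballI continuous_intros isCont_o2[of _ exp f] schwartz_pos_isCont[OF f]) auto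

text \<open>Exponential decay at both ends in \<open>u = ln x\<close> is one additional power of
  \<open>x\<close> at infinity and one at 0.\<close>

lemma schwartz_pos_exp_bound:
  obtains C where "\<And>u. norm (of_real (exp ((1 - \<sigma>) * u)) * f (exp u)) * (exp u + exp (- u)) \<le> C"
proof -
  obtain A where A: "\<And>x. x > 0 \<Longrightarrow> norm (f x) * x powr (1 - \<sigma> + 1) \<le> A" using schwartz_pos_bound[OF f] by blast
  obtain B where B: "\<And>x. x > 0 \<Longrightarrow> norm (f x) * x powr (1 - \<sigma> - 1) \<le> B" using schwartz_pos_bound[OF f] by blast
  have "norm (of_real (exp ((1 - \<sigma>) * u)) * f (exp u)) * (exp u + exp (- u)) =
      norm (f (exp u)) * exp u powr (1 - \<sigma> + 1) + norm (f (exp u)) * exp u powr (1 - \<sigma> - 1)" for u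
  proof -
    have "exp u powr (1 - \<sigma> + 1) = exp ((1 - \<sigma>) * u) * exp u"
         "exp u powr (1 - \<sigma> - 1) = exp ((1 - \<sigma>) * u) * exp (- u)"
      by (simp_all add: powr_def exp_add[symmetric] algebra_simps)
    then show ?thesis by (simp only: norm_mult norm_of_real abs_exp_cancel) (simp add: algebra_simps)
  qed
  also have "\<dots> u \<le> A + B" for u by (intro add_mono A B) auto
  finally show ?thesis by (rule that)
qed

lemma schwartz_pos_exp_integrable:
  "integrable lborel (\<lambda>u. of_real (exp ((1 - \<sigma>) * u)) * f (exp u))"
proof -
  obtain C where C: "\<And>u. norm (of_real (exp ((1 - \<sigma>) * u)) * f (exp u)) * (exp u + exp (- u)) \<le> C"
    using schwartz_pos_exp_bound by blast
  show ?thesis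
  proof (rule Bochner_Integration.integrable_bound)
    show "integrable lborel (\<lambda>u::real. C * inverse (exp u + exp (- u)))"
      using integrable_inverse_exp_sum by simp
    show "(\<lambda>u. of_real (exp ((1 - \<sigma>) * u)) * f (exp u)) \<in> borel_measurable lborel"
      using schwartz_pos_exp_continuous by (simp add: borel_measurable_continuous_onI)
    have "norm (of_real (exp ((1 - \<sigma>) * u)) * f (exp u)) \<le> C * inverse (exp u + exp (- u))" for u
      using C[of u] by (simp add: field_simps add_pos_pos)
    then show "AE u in lborel. norm (of_real (exp ((1 - \<sigma>) * u)) * f (exp u)) \<le> norm (C * inverse (exp u + exp (- u)))"
      by (intro AE_I2) (auto intro: order.trans[OF _ abs_ge_self])
  qed
qed

text \<open>The substitution \<open>x = exp u\<close>; the weight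
  \<open>exp ((1 - \<sigma>) * u)\<close> combines \<open>x powr (- \<sigma>)\<close> with the
  Jacobian \<open>exp u\<close>.\<close>

lemma mellin_eq_fourier:
  "mellin f (1 - Complex \<sigma> t) =
     (\<integral>u. of_real (exp ((1 - \<sigma>) * u)) * f (exp u) * exp (- (\<i> * of_real (t * u))) \<partial>lborel)"
proof -
  have [simp]: "einterval 0 \<infinity> = {0<..}" "einterval (-\<infinity>) \<infinity> = UNIV" by (auto simp: einterval_def)
  let ?h = "\<lambda>x. f x * complex_of_real x powr (- Complex \<sigma> t)"
  have eq: "exp u *\<^sub>R ?h (exp u) = of_real (exp ((1 - \<sigma>) * u)) * f (exp u) * exp (- (\<i> * of_real (t * u)))" for u
  proof -
    have "complex_of_real (exp u) powr (- Complex \<sigma> t) = exp (- Complex \<sigma> t * of_real u)"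
      using powr_eq_exp_ln[of "exp u"] by simp
    then have "complex_of_real (exp u) * of_real (exp u) powr (- Complex \<sigma> t) =
        of_real (exp ((1 - \<sigma>) * u)) * exp (- (\<i> * of_real (t * u)))"
      by (simp add: exp_of_real[symmetric] exp_add[symmetric] Complex_eq algebra_simps)
    then show ?thesis by (simp add: scaleR_conv_of_real mult_ac)
  qed
  have "(LBINT x=0..\<infinity>. ?h x) = (LBINT u=-\<infinity>..\<infinity>. exp u *\<^sub>R ?h (exp u))"
  proof (rule interval_integral_substitution_integrable)
    show "(-\<infinity>::ereal) < \<infinity>" by simp
    show "DERIV exp u :> exp u" for u :: real by (rule DERIV_exp)
    show "isCont ?h (exp u)" for u by (rule schwartz_pos_times_powr_isCont[OF f]) simp
    show "isCont exp u" for u :: real by (intro continuous_intros)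
    show "0 \<le> exp u" for u :: real by simp
    show "((ereal \<circ> exp \<circ> real_of_ereal) \<longlongrightarrow> 0) (at_right (-\<infinity>))"
      unfolding zero_ereal_def by (simp add: ereal_tendsto_simps exp_at_bot)
    show "((ereal \<circ> exp \<circ> real_of_ereal) \<longlongrightarrow> \<infinity>) (at_left \<infinity>)"
      by (simp add: ereal_tendsto_simps exp_at_top)
    show "set_integrable lborel (einterval 0 \<infinity>) ?h"
      using schwartz_pos_set_integrable[OF f] by simp
    show "set_integrable lborel (einterval (-\<infinity>) \<infinity>) (\<lambda>u. exp u *\<^sub>R ?h (exp u))"
      unfolding eq set_integrable_def
    proof (rule Bochner_Integration.integrable_bound[OF schwartz_pos_exp_integrable])
      have [measurable]: "(\<lambda>u. of_real (exp ((1 - \<sigma>) * u)) * f (exp u)) \<in> borel_measurable borel"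
        using schwartz_pos_exp_continuous by (simp add: borel_measurable_continuous_onI)
      show "(\<lambda>u. indicator (einterval (-\<infinity>) \<infinity>) u *\<^sub>R (of_real (exp ((1 - \<sigma>) * u)) * f (exp u) * exp (- (\<i> * of_real (t * u)))))
          \<in> borel_measurable lborel" by simp
    qed (simp add: norm_mult)
  qed
  then show ?thesis
    unfolding eq by (simp add: interval_lebesgue_integral_def mellin_def set_lebesgue_integral_def)
qed

lemma mellin_vertical_measurable:
  "(\<lambda>t. mellin f (1 - Complex \<sigma> t)) \<in> borel_measurable borel"
proof -
  have [measurable]: "(\<lambda>u. of_real (exp ((1 - \<sigma>) * u)) * f (exp u)) \<in> borel_measurable borel"
    using schwartz_pos_exp_continuous by (simp add: borel_measurable_continuous_onI)
  show ?thesis unfolding mellin_eq_fourier by measurable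
qed

lemma mellin_reflected_decay:
  "\<exists>C. \<forall>t. norm (mellin f (1 - Complex \<sigma> t)) * (1 + t\<^sup>2) ^ N \<le> C"
proof -
  obtain C where C: "\<And>t. norm (mellin f (Complex (1 - \<sigma>) t)) * (1 + t\<^sup>2) ^ N \<le> C"
    using mellin_vertical_decay[OF f] by blast
  have "1 - Complex \<sigma> t = Complex (1 - \<sigma>) (- t)" for t by (simp add: complex_eq_iff)
  then have "norm (mellin f (1 - Complex \<sigma> t)) * (1 + t\<^sup>2) ^ N \<le> C" for t
    using C[of "- t"] by simp
  then show ?thesis by blast
qed

text \<open>Fourier inversion at \<open>ln y\<close> for the weighted function of \<open>u\<close>;
  the factor \<open>y powr (\<sigma> - 1)\<close> then undoes the weight.\<close>

lemma mellin_inversion: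
  assumes "y > 0"
  shows "f y = (\<integral>t. mellin f (1 - Complex \<sigma> t) * of_real y powr (Complex \<sigma> t - 1) \<partial>lborel) / (2 * pi)"
proof -
  let ?g = "\<lambda>u. complex_of_real (exp ((1 - \<sigma>) * u)) * f (exp u)"
  obtain C where C: "\<And>u. norm (?g u) * (exp u + exp (- u)) \<le> C"
    using schwartz_pos_exp_bound by blast
  have bound: "norm (?g u) \<le> C" for u
  proof -
    have "1 \<le> exp u + exp (- u)"
      by (cases "u \<ge> 0") (auto simp: add_increasing add_increasing2)
    then have "norm (?g u) * 1 \<le> norm (?g u) * (exp u + exp (- u))"
      by (intro mult_left_mono) auto
    with C[of u] show ?thesis by simp
  qed
  have "integrable lborel (\<lambda>t. mellin f (1 - Complex \<sigma> t))"
    using integrable_lborel_if_quadratic_decay[OF mellin_vertical_measurable] mellin_reflected_decay[of 1] by auto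
  then have "(\<integral>t. mellin f (1 - Complex \<sigma> t) * exp (\<i> * of_real (t * ln y)) \<partial>lborel) = 2 * pi * ?g (ln y)"
    using fourier_inversion[OF schwartz_pos_exp_integrable schwartz_pos_exp_continuous bound, of "ln y"]
    unfolding mellin_eq_fourier by simp
  also have "?g (ln y) = of_real (y powr (1 - \<sigma>)) * f y"
    using assms by (simp add: powr_def)
  finally have "f y = of_real (y powr (\<sigma> - 1)) * (\<integral>t. mellin f (1 - Complex \<sigma> t) * exp (\<i> * of_real (t * ln y)) \<partial>lborel) / (2 * pi)"
    using assms by (simp add: powr_diff field_simps)
  also have "of_real (y powr (\<sigma> - 1)) * (\<integral>t. mellin f (1 - Complex \<sigma> t) * exp (\<i> * of_real (t * ln y)) \<partial>lborel)
     = (\<integral>t. mellin f (1 - Complex \<sigma> t) * of_real y powr (Complex \<sigma> t - 1) \<partial>lborel)"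
  proof -
    have "of_real y powr (Complex \<sigma> t - 1) = of_real (y powr (\<sigma> - 1)) * exp (\<i> * of_real (t * ln y))" for t
      using assms by (simp add: powr_def Ln_of_real exp_of_real[symmetric] exp_add[symmetric] Complex_eq algebra_simps)
    then show ?thesis
      unfolding integral_mult_right_zero[symmetric] by (simp only: mult_ac)
  qed
  finally show ?thesis .
qed

end

subsection \<open>Iterated integrals\<close>

text \<open>The base case. As \<open>f\<close> is integrable against every power of
  \<open>x\<close>, all vertical lines are available and \<open>c\<close> is arbitrary.\<close>

lemma inverse_mellin_rep_schwartz_pos:
  "f \<in> schwartz_pos \<Longrightarrow> inverse_mellin_rep c (\<lambda>s. mellin f (1 - s)) f"
  unfolding inverse_mellin_rep_def
  by (intro allI impI conjI mellin_vertical_measurable mellin_reflected_decay mellin_inversion)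

lemma inverse_mellin_rep_mono:
  "inverse_mellin_rep c K J \<Longrightarrow> c \<le> c' \<Longrightarrow> inverse_mellin_rep c' K J"
  by (simp add: inverse_mellin_rep_def)

text \<open>No convergence is involved: a non-integrable function has integral 0, and a nonzero
  factor preserves non-integrability.\<close>

lemma iterated_integral_mult_left:
  "iterated_integral n (\<lambda>xs. a * f xs) = a * iterated_integral n f"
  by (induction n arbitrary: f) simp_all

lemma iterated_integral_converges_mult_left:
  "iterated_integral_converges n f \<Longrightarrow> iterated_integral_converges n (\<lambda>xs. a * f xs)"
  by (induction n arbitrary: f) (simp_all add: iterated_integral_mult_left)

text \<open>The outermost variable enters \<open>f\<close> only through the product, so fixing it
  rescales \<open>x\<close>. In terms of \<open>y = 1 / x\<close> this is the dilation from
  \<open>y\<close> to \<open>y * t\<close>.\<close>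

lemma hankel_integrand_Cons:
  "hankel_integrand (Suc n) sg lam f x (t # xs) =
     (of_real t powr (- lam 0) * exp (of_real (sg 0) * \<i> * of_real t)) *
     hankel_integrand n (sg \<circ> Suc) (lam \<circ> Suc) f (x / t) xs"
proof -
  have "(\<Prod>l<Suc n. (t # xs) ! l) / x = (\<Prod>l<n. xs ! l) / (x / t)"
    by (simp add: prod.lessThan_Suc_shift del: prod.lessThan_Suc)
  then show ?thesis
    unfolding hankel_integrand_def
    by (simp add: prod.lessThan_Suc_shift mult_ac del: prod.lessThan_Suc)
qed

lemma gamma_product_Suc:
  "gamma_product (Suc n) sg lam s = Gamma (s - lam 0) * ee (of_real (sg 0) * (s - lam 0) / 4) *
     gamma_product n (sg \<circ> Suc) (lam \<circ> Suc) s"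
  unfolding gamma_product_def by (simp add: prod.lessThan_Suc_shift del: prod.lessThan_Suc)

text \<open>Convergence and representation go through the induction together, since the outermost
  integral converges by virtue of the representation of the inner ones. Quantifying over
  \<open>c\<close> leaves room to choose it strictly below the next
  \<open>Re (lam 0)\<close>.\<close>

lemma hankel_iterated_integral:
  assumes f: "f \<in> schwartz_pos" and "\<forall>l<n. sg l \<in> {1, -1}"
    and "\<forall>l m. l < m \<and> m < n \<longrightarrow> Re (lam l) > Re (lam m)"
  shows "(\<forall>x>0. iterated_integral_converges n (hankel_integrand n sg lam f x)) \<and>
         (\<forall>c. (\<forall>l<n. Re (lam l) \<le> c) \<longrightarrow>
            inverse_mellin_rep c (\<lambda>s. gamma_product n sg lam s * mellin f (1 - s))
              (\<lambda>y. iterated_integral n (hankel_integrand n sg lam f (1 / y))))"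
  using assms(2,3)
proof (induction n arbitrary: sg lam)
  case 0
  then show ?case
    using inverse_mellin_rep_schwartz_pos[OF f] by (simp add: hankel_integrand_def gamma_product_def)
next
  case (Suc n)
  let ?sg = "sg \<circ> Suc" and ?lam = "lam \<circ> Suc"
  define J where "J = (\<lambda>y. iterated_integral n (hankel_integrand n ?sg ?lam f (1 / y)))"
  let ?k = "\<lambda>t. complex_of_real t powr (- lam 0) * exp (of_real (sg 0) * \<i> * of_real t)"
  have "\<forall>l<n. ?sg l \<in> {1, -1}" "\<forall>l m. l < m \<and> m < n \<longrightarrow> Re (?lam l) > Re (?lam m)"
    using Suc.prems by simp_all
  note Suc_IH = Suc.IH[OF this]
  have conv: "iterated_integral_converges n (hankel_integrand n ?sg ?lam f x)" if "x > 0" for x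
    using Suc_IH that by blast
  have IH: "inverse_mellin_rep c (\<lambda>s. gamma_product n ?sg ?lam s * mellin f (1 - s)) J"
    if "\<forall>l<n. Re (?lam l) \<le> c" for c
    using Suc_IH that unfolding J_def by blast
  \<comment> \<open>Without inner variables any number below \<open>Re (lam 0)\<close> works;
    otherwise \<open>Re (lam 1)\<close> is the largest real part among the remaining
    parameters.\<close>
  obtain c where c: "c < Re (lam 0)" "\<forall>l<n. Re (?lam l) \<le> c"
  proof (cases n)
    case 0
    then show ?thesis using that[of "Re (lam 0) - 1"] by simp
  next
    case (Suc m)
    have "Re (lam (Suc l)) \<le> Re (lam 1)" if "l < n" for l
      using Suc.prems(2)[rule_format, of 1 "Suc l"] that by (cases "l = 0") (auto simp: less_imp_le)
    then show ?thesis
      using that[of "Re (lam 1)"] Suc.prems(2)[rule_format, of 0 1] Suc by simp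
  qed
  have sg: "sg 0 \<in> {1, -1}" using Suc.prems(1) by blast
  note rep = IH[OF c(2)] c(1) sg
  have split: "iterated_integral n (\<lambda>xs. hankel_integrand (Suc n) sg lam f x (t # xs)) = ?k t * J (1 / x * t)" for x t
    unfolding hankel_integrand_Cons iterated_integral_mult_left by (simp add: J_def)
  have "iterated_integral_converges (Suc n) (hankel_integrand (Suc n) sg lam f x)" if x: "x > 0" for x
  proof -
    have "set_integrable lborel {0<..} (\<lambda>t. ?k t * J (1 / x * t))"
      using oscillatory_set_integrable[OF rep, of "1 / x"] x by simp
    moreover have "iterated_integral_converges n (\<lambda>xs. hankel_integrand (Suc n) sg lam f x (t # xs))" if "t > 0" for t
      unfolding hankel_integrand_Cons
      using x that by (intro iterated_integral_converges_mult_left conv) simp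
    ultimately show ?thesis by (simp add: split)
  qed
  moreover have "inverse_mellin_rep c' (\<lambda>s. gamma_product (Suc n) sg lam s * mellin f (1 - s))
      (\<lambda>y. iterated_integral (Suc n) (hankel_integrand (Suc n) sg lam f (1 / y)))"
    if c': "\<forall>l<Suc n. Re (lam l) \<le> c'" for c'
  proof -
    have "inverse_mellin_rep (Re (lam 0)) (\<lambda>s. gamma_product (Suc n) sg lam s * mellin f (1 - s))
      (\<lambda>y. LINT t:{0<..}|lborel. ?k t * J (y * t))"
      using inverse_mellin_rep_oscillatory[OF rep] by (simp add: gamma_product_Suc mult.assoc)
    then show ?thesis
      using c' by (auto simp: split intro: inverse_mellin_rep_mono)
  qed
  ultimately show ?case by blast
qed

theorem theorem5p10:
  fixes n :: nat and sg :: "nat \<Rightarrow> real" and lam :: "nat \<Rightarrow> complex"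
    and \<upsilon> :: "real \<Rightarrow> complex" and \<sigma> x :: real
  assumes "n \<ge> 1"
    and "\<forall>l<n. sg l \<in> {1, -1}"
    and "\<forall>l m. l < m \<and> m < n \<longrightarrow> Re (lam l) > Re (lam m)"
    and "\<upsilon> \<in> schwartz_pos"
    and "\<sigma> > Max ((\<lambda>l. Re (lam l)) ` {..<n})"
    and "x > 0"
  shows "iterated_integral_converges n (hankel_integrand n sg lam \<upsilon> x) \<and>
         hankel_transform n sg lam \<sigma> \<upsilon> x =
           1 / complex_of_real x * iterated_integral n (hankel_integrand n sg lam \<upsilon> x)"
proof
  note main = hankel_iterated_integral[OF assms(4,2,3)]
  show "iterated_integral_converges n (hankel_integrand n sg lam \<upsilon> x)"
    using main assms(6) by blast
  define c where "c = Max ((\<lambda>l. Re (lam l)) ` {..<n})"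
  have "\<forall>l<n. Re (lam l) \<le> c" unfolding c_def by (auto intro: Max_ge)
  with main have "inverse_mellin_rep c (\<lambda>s. gamma_product n sg lam s * mellin \<upsilon> (1 - s))
              (\<lambda>y. iterated_integral n (hankel_integrand n sg lam \<upsilon> (1 / y)))" by blast
  moreover have "c < \<sigma>" using assms(5) by (simp add: c_def)
  ultimately have I: "iterated_integral n (hankel_integrand n sg lam \<upsilon> (1 / y)) =
      (\<integral>t. gamma_product n sg lam (Complex \<sigma> t) * mellin \<upsilon> (1 - Complex \<sigma> t) *
            of_real y powr (Complex \<sigma> t - 1) \<partial>lborel) / (2 * pi)" if "y > 0" for y
    using that unfolding inverse_mellin_rep_def by blast
  \<comment> \<open>The Hankel transform carries \<open>x powr (- s)\<close>, the representation at
    \<open>y = 1 / x\<close> carries \<open>y powr (s - 1)\<close>; the discrepancy is the prefactor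
    \<open>1 / x\<close> of the formula.\<close>
  have x: "of_real x powr (- s) = 1 / of_real x * of_real (1 / x) powr (s - 1)" for s :: complex
  proof -
    have "of_real x powr (- s) = of_real (1 / x) powr s"
      using assms(6) powr_eq_exp_ln[of "1 / x" s] by (simp add: powr_eq_exp_ln ln_div)
    also have "\<dots> = of_real (1 / x) powr (1 + (s - 1))" by simp
    also have "\<dots> = of_real (1 / x) * of_real (1 / x) powr (s - 1)"
      using assms(6) by (subst powr_add) simp
    finally show ?thesis by simp
  qed
  have "hankel_transform n sg lam \<sigma> \<upsilon> x = 1 / (2 * pi * \<i>) *
     (\<integral>t. \<i> / of_real x * (gamma_product n sg lam (Complex \<sigma> t) * mellin \<upsilon> (1 - Complex \<sigma> t) *
            of_real (1 / x) powr (Complex \<sigma> t - 1)) \<partial>lborel)"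
    unfolding hankel_transform_def vertical_line_integral_def x by (simp add: mult_ac)
  also have "\<dots> = 1 / (2 * pi * \<i>) * (\<i> / of_real x * (2 * pi * iterated_integral n (hankel_integrand n sg lam \<upsilon> x)))"
    unfolding integral_mult_right_zero using I[of "1 / x"] assms(6) by simp
  also have "\<dots> = 1 / of_real x * iterated_integral n (hankel_integrand n sg lam \<upsilon> x)"
    by (simp add: field_simps)
  finally show "hankel_transform n sg lam \<sigma> \<upsilon> x =
           1 / complex_of_real x * iterated_integral n (hankel_integrand n sg lam \<upsilon> x)" .
qed

end
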